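(* For every $\tau\in\mathbb{H}^2$, $$\frac{\theta'[1,\frac13]}{\theta[1,\frac13]}=-\frac13\,\frac{\theta'[1,1]\,\theta^3[1,\frac13]}{\theta[1,0]\,\theta^3[1,\frac23]}+\frac{\theta'[1,1]\,\theta[1,0]\,\theta[0,\frac13]\,\theta[0,\frac23]}{\theta[0,0]\,\theta[0,1]\,\theta[1,\frac13]\,\theta[1,\frac23]}$$ $$=\frac{\pi}{3}\,\theta[0,0]\,\theta[0,1]\,\frac{\theta^3[1,\frac13]}{\theta^3[1,\frac23]}-\pi\,\theta^2[1,0]\,\frac{\theta[0,\frac13]\,\theta[0,\frac23]}{\theta[1,\frac13]\,\theta[1,\frac23]}.$$
   Context: $\mathbb{H}^2=\{\tau\in\mathbb{C} : \Im\tau>0\}$ is the upper half plane. For $\epsilon,\epsilon'\in\mathbb{R}$, $\zeta\in\mathbb{C}$, $\tau\in\mathbb{H}^2$, the theta function with characteristics is $$\theta[\epsilon,\epsilon'](\zeta,\tau)=\sum_{n\in\mathbb{Z}}\exp\left(2\pi i\left[\tfrac12\left(n+\tfrac{\epsilon}{2}\right)^2\tau+\left(n+\tfrac{\epsilon}{2}\right)\left(\zeta+\tfrac{\epsilon'}{2}\right)\right]\right).$$ Write $\theta[\epsilon,\epsilon']=\theta[\epsilon,\epsilon'](0,\tau)$ and $\theta'[\epsilon,\epsilon']=\frac{\partial}{\partial\zeta}\theta[\epsilon,\epsilon'](\zeta,\tau)\big|_{\zeta=0}$; $\theta^k[\epsilon,\epsilon']$ means the $k$-th power of $\theta[\epsilon,\epsilon']$.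 *)

theory Defs
  imports "HOL-Analysis.Analysis"
begin

definition theta_char :: "real \<Rightarrow> real \<Rightarrow> complex \<Rightarrow> complex \<Rightarrow> complex" where
  "theta_char \<epsilon> \<epsilon>' \<zeta> \<tau> =
     (\<Sum>\<^sub>\<infinity>n\<in>(UNIV :: int set).
        exp (2 * of_real pi * \<i> *
          (1 / 2 * (of_int n + of_real \<epsilon> / 2)\<^sup>2 * \<tau>
           + (of_int n + of_real \<epsilon> / 2) * (\<zeta> + of_real \<epsilon>' / 2))))"

definition theta_const :: "real \<Rightarrow> real \<Rightarrow> complex \<Rightarrow> complex" where
  "theta_const \<epsilon> \<epsilon>' \<tau> = theta_char \<epsilon> \<epsilon>' 0 \<tau>"

definition theta_deriv_const :: "real \<Rightarrow> real \<Rightarrow> complex \<Rightarrow> complex" where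
  "theta_deriv_const \<epsilon> \<epsilon>' \<tau> = deriv (\<lambda>\<zeta>. theta_char \<epsilon> \<epsilon>' \<zeta> \<tau>) 0"

end

theory Submission
  imports Defs "HOL-Complex_Analysis.Complex_Analysis" "HOL-Library.Nat_Bijection"
begin

text \<open>
  Write \<open>\<theta>\<close> for \<^const>\<open>theta_char\<close> with its characteristic as index and \<open>\<theta>\<^sub>1\<^sub>1'\<close> for the
  derivative in the first variable. Since \<open>\<theta>\<^sub>1\<^sub>1\<close> is odd and the characteristic \<open>\<epsilon>'\<close> is a translation by
  \<open>\<epsilon>' / 2\<close>, all constants in the theorem are values of four functions at the division points \<open>1 / 3\<close>
  and \<open>1 / 6\<close>. Two identities between such values combine to the theorem.

  The first identity is the Wronskian relation \<open>\<theta>\<^sub>1\<^sub>1' \<theta>\<^sub>1\<^sub>0 - \<theta>\<^sub>1\<^sub>1 \<theta>\<^sub>1\<^sub>0' = d \<theta>\<^sub>0\<^sub>0 \<theta>\<^sub>0\<^sub>1\<close>, with \<open>d\<close> determined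
  at \<open>0\<close>. At \<open>- 1 / 3\<close> it expresses \<open>\<theta>\<^sub>1\<^sub>1' / \<theta>\<^sub>1\<^sub>1\<close> at \<open>- 1 / 3\<close> through \<open>\<theta>\<^sub>1\<^sub>1' / \<theta>\<^sub>1\<^sub>1\<close> at
  \<open>1 / 6\<close> and yields the second summand of the theorem. The second identity is
  \<open>\<theta>\<^sub>1\<^sub>1(z - 1/6)\<^sup>3 + \<theta>\<^sub>1\<^sub>1(z + 1/6)\<^sup>3 = c \<theta>\<^sub>1\<^sub>1(z) \<theta>\<^sub>0\<^sub>0(z) \<theta>\<^sub>0\<^sub>1(z)\<close>. The value at \<open>1 / 2\<close> determines \<open>c\<close>, and
  the derivative at \<open>0\<close> then gives \<open>\<theta>\<^sub>1\<^sub>1' / \<theta>\<^sub>1\<^sub>1\<close> at \<open>1 / 6\<close> as a quotient of cubes, which is the first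
  summand. The second form of the right-hand side follows from Jacobi's derivative formula
  \<open>\<theta>\<^sub>1\<^sub>1'(0) = - \<pi> \<theta>\<^sub>0\<^sub>0(0) \<theta>\<^sub>0\<^sub>1(0) \<theta>\<^sub>1\<^sub>0(0)\<close>.

  Both functional identities have the same proof. The two sides are quasi-periodic with the same factors
  under the lattice spanned by \<open>1\<close> and \<open>\<tau>\<close>. The right-hand side has only simple zeros, at half periods or lattice points, and
  there the left-hand side vanishes as well, because its parity is incompatible with its factors
  (\<open>quasi_periodic_half_period_zero\<close>). So the quotient is entire and doubly periodic, hence constant by
  Liouville's theorem (\<open>quasi_periodic_proportional\<close>).

  The location and simplicity of the zeros, the holomorphy of \<open>\<theta>\<close>, and the constant in Jacobi's derivative
  formula all come from the Jacobi triple product. It is obtained as the limit of a finite product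
  expansion whose coefficients are central \<open>q\<close>-binomial coefficients. The limit is locally uniform, so
  it also carries over derivatives (\<open>jacobi_prod_limits\<close>).
\<close>

section \<open>The finite triple product\<close>

definition qpoch :: "complex \<Rightarrow> nat \<Rightarrow> complex" where
  "qpoch p n = (\<Prod>k<n. 1 - p ^ Suc k)"

text \<open>
  The value \<open>0\<close> at negative integers makes the recursion \<open>inv_qpoch_step\<close> valid for every integer, and makes
  the binomial coefficients below vanish outside their range.
\<close>

definition inv_qpoch :: "complex \<Rightarrow> int \<Rightarrow> complex" where
  "inv_qpoch p m = (if m < 0 then 0 else 1 / qpoch p (nat m))"

definition central_qbinom :: "complex \<Rightarrow> nat \<Rightarrow> int \<Rightarrow> complex" where
  "central_qbinom p N j = qpoch p (2 * N) * inv_qpoch p (int N + j) * inv_qpoch p (int N - j)"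

definition jacobi_factor :: "complex \<Rightarrow> complex \<Rightarrow> nat \<Rightarrow> complex" where
  "jacobi_factor q w k = (1 + q ^ (2 * k + 1) * w) * (1 + q ^ (2 * k + 1) / w)"

lemma one_minus_power_nonzero:
  fixes p :: complex
  assumes "norm p < 1"
  shows "1 - p ^ Suc k \<noteq> 0"
proof
  assume "1 - p ^ Suc k = 0"
  then have "norm p ^ Suc k = 1" by (metis eq_iff_diff_eq_0 norm_one norm_power)
  with assms show False
    using power_Suc_less_one[of "norm p" k] by (cases "norm p = 0") auto
qed

lemma qpoch_nonzero: "norm p < 1 \<Longrightarrow> qpoch p n \<noteq> 0"
  unfolding qpoch_def using one_minus_power_nonzero[of p] by (simp add: prod_zero_iff del: power_Suc)

lemma inv_qpoch_step:
  assumes "norm p < 1" "p \<noteq> 0"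
  shows "inv_qpoch p (m - 1) = (1 - p powi m) * inv_qpoch p m"
proof (cases "m \<le> 0")
  case True
  then show ?thesis by (cases "m = 0") (auto simp: inv_qpoch_def)
next
  case False
  then obtain n where n: "m = int (Suc n)"
    by (metis gr0_implies_Suc not_le zero_less_imp_eq_int)
  have "qpoch p (Suc n) = qpoch p n * (1 - p ^ Suc n)" by (simp add: qpoch_def)
  moreover have "p powi m = p ^ Suc n" unfolding n by (rule power_int_of_nat)
  moreover have "inv_qpoch p m = 1 / qpoch p (Suc n)" by (simp add: inv_qpoch_def n del: of_nat_Suc)
  moreover have "inv_qpoch p (m - 1) = 1 / qpoch p n" by (simp add: inv_qpoch_def n)
  ultimately show ?thesis
    using one_minus_power_nonzero[OF assms(1), of n] qpoch_nonzero[OF assms(1), of n]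
    by (simp del: power_Suc)
qed

text \<open>
  The recursion that multiplication by the next Jacobi factor imposes on the coefficients of
  \<open>w powi j\<close>. All the reciprocals involved are polynomial multiples of the two with the largest arguments
  \<open>N + 1 \<plusminus> j\<close>, so after these are factored out a polynomial identity in \<open>x = q ^ (2 * N + 1)\<close>,
  \<open>y = q powi (2 * j)\<close> and their inverses remains, with no separate treatment of \<open>\<bar>j\<bar> > N\<close>.
\<close>

lemma central_qbinom_step:
  assumes q: "norm q < 1" "q \<noteq> 0"
  shows "central_qbinom (q\<^sup>2) (Suc N) j * q powi (j\<^sup>2) =
      (1 + q ^ (4 * N + 2)) * (central_qbinom (q\<^sup>2) N j * q powi (j\<^sup>2))
    + q ^ (2 * N + 1) * (central_qbinom (q\<^sup>2) N (j - 1) * q powi ((j - 1)\<^sup>2)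
                       + central_qbinom (q\<^sup>2) N (j + 1) * q powi ((j + 1)\<^sup>2))"
proof -
  define p where "p = q\<^sup>2"
  have p: "norm p < 1" "p \<noteq> 0"
    using q by (auto simp: p_def norm_power power_less_one_iff)
  define x where "x = q ^ (2 * N + 1)"
  define y where "y = p powi j"
  define a where "a = inv_qpoch p (int N + 1 + j)"
  define b where "b = inv_qpoch p (int N + 1 - j)"
  have nz: "x \<noteq> 0" "y \<noteq> 0" using q p by (auto simp: x_def y_def)
  have y2: "y = q powi (2 * j)" by (simp add: y_def p_def power_int_mult)
  have X1: "p powi (int N + 1) = x * q"
    using p(2) by (simp add: p_def x_def power_int_add power_mult power2_eq_square)
  have X0: "p powi (int N) = x / q"
    using q by (simp add: p_def x_def power_mult)
  have A1: "inv_qpoch p (int N + j) = (1 - x * q * y) * a"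
    using inv_qpoch_step[OF p, of "int N + 1 + j"] X1 p(2)
    by (simp add: a_def y_def power_int_add add.commute add.left_commute)
  have A2: "inv_qpoch p (int N + j - 1) = (1 - x / q * y) * ((1 - x * q * y) * a)"
    using inv_qpoch_step[OF p, of "int N + j"] X0 p(2) A1
    by (simp add: y_def power_int_add)
  have B1: "inv_qpoch p (int N - j) = (1 - x * q / y) * b"
    using inv_qpoch_step[OF p, of "int N + 1 - j"] X1 p(2)
    by (simp add: b_def y_def power_int_diff)
  have B2: "inv_qpoch p (int N - j - 1) = (1 - x / q / y) * ((1 - x * q / y) * b)"
    using inv_qpoch_step[OF p, of "int N - j"] X0 p(2) B1
    by (simp add: y_def power_int_diff)
  have P: "qpoch p (2 * Suc N) = qpoch p (2 * N) * (1 - x\<^sup>2) * (1 - (x * q)\<^sup>2)"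
  proof -
    have "p ^ Suc (2 * N) = x\<^sup>2" "p ^ Suc (Suc (2 * N)) = (x * q)\<^sup>2"
      by (simp_all add: p_def x_def power_mult power_mult_distrib power2_eq_square mult_ac)
    then show ?thesis by (simp add: qpoch_def del: power_Suc)
  qed
  have Q1: "q powi ((j - 1)\<^sup>2) = q powi (j\<^sup>2) * (q / y)"
  proof -
    have "(j - 1)\<^sup>2 = j\<^sup>2 + (1 - 2 * j)" by (simp add: power2_eq_square algebra_simps)
    then show ?thesis using q(2) by (simp add: power_int_add power_int_diff y2)
  qed
  have Q2: "q powi ((j + 1)\<^sup>2) = q powi (j\<^sup>2) * (q * y)"
  proof -
    have "(j + 1)\<^sup>2 = j\<^sup>2 + (1 + 2 * j)" by (simp add: power2_eq_square algebra_simps)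
    then show ?thesis using q(2) by (simp add: power_int_add y2)
  qed
  have x2: "q ^ (4 * N + 2) = x\<^sup>2"
    unfolding x_def power_mult[symmetric] by (rule arg_cong[of _ _ "\<lambda>m. q ^ m"]) simp
  have *: "(1 - x\<^sup>2) * (1 - (x * q)\<^sup>2) =
      (1 + x\<^sup>2) * ((1 - x * q * y) * (1 - x * q / y))
    + x * ((1 - x / q * y) * (1 - x * q * y) * (q / y)
         + (1 - x * q / y) * (1 - x / q / y) * (q * y))"
    using nz q(2) by (simp add: field_simps) (simp add: power2_eq_square power4_eq_xxxx algebra_simps)
  have "central_qbinom p (Suc N) j * q powi (j\<^sup>2)
      = qpoch p (2 * N) * a * b * q powi (j\<^sup>2) * ((1 - x\<^sup>2) * (1 - (x * q)\<^sup>2))"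
    unfolding central_qbinom_def P by (simp add: a_def b_def add.commute add.left_commute mult_ac)
  also have "\<dots> = (1 + x\<^sup>2) * (central_qbinom p N j * q powi (j\<^sup>2))
    + x * (central_qbinom p N (j - 1) * q powi ((j - 1)\<^sup>2)
                       + central_qbinom p N (j + 1) * q powi ((j + 1)\<^sup>2))"
  proof -
    have "inv_qpoch p (int N + (j - 1)) = (1 - x / q * y) * ((1 - x * q * y) * a)"
         "inv_qpoch p (int N - (j - 1)) = b"
         "inv_qpoch p (int N + (j + 1)) = a"
         "inv_qpoch p (int N - (j + 1)) = (1 - x / q / y) * ((1 - x * q / y) * b)"
      using A2 B2 by (simp_all add: a_def b_def algebra_simps)
    moreover have "Q * a * b * e * ((1 + X) * (\<beta> * \<gamma>) + x * (\<alpha> * \<beta> * u + \<gamma> * \<delta> * v))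
        = (1 + X) * (Q * (\<beta> * a) * (\<gamma> * b) * e)
        + x * (Q * (\<alpha> * (\<beta> * a)) * b * (e * u) + Q * a * (\<delta> * (\<gamma> * b)) * (e * v))"
      for Q e X u v \<alpha> \<beta> \<gamma> \<delta> :: complex
      by algebra
    ultimately show ?thesis
      unfolding * central_qbinom_def A1 B1 Q1 Q2 by (simp only:)
  qed
  finally show ?thesis by (simp only: p_def x2 x_def[symmetric])
qed

text \<open>
  The sum over all integers has only finitely many non-zero terms. Being indexed by all integers, it can be
  shifted freely in the induction step.
\<close>

lemma finite_triple_product:
  assumes q: "norm q < 1" "q \<noteq> 0" and w: "w \<noteq> 0"
  shows "((\<lambda>j. central_qbinom (q\<^sup>2) N j * q powi (j\<^sup>2) * w powi j)
            has_sum (\<Prod>k<N. jacobi_factor q w k)) UNIV"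
proof (induction N)
  case 0
  have "((\<lambda>j. central_qbinom (q\<^sup>2) 0 j * q powi (j\<^sup>2) * w powi j) has_sum
          (\<Sum>j\<in>{0}. central_qbinom (q\<^sup>2) 0 j * q powi (j\<^sup>2) * w powi j)) UNIV"
    by (rule has_sum_finite_neutralI[where B = "{0}"]) (auto simp: central_qbinom_def inv_qpoch_def)
  then show ?case by (simp add: central_qbinom_def inv_qpoch_def qpoch_def)
next
  case (Suc N)
  define f where "f = (\<lambda>j. central_qbinom (q\<^sup>2) N j * q powi (j\<^sup>2) * w powi j)"
  define F where "F = (\<Prod>k<N. jacobi_factor q w k)"
  have F: "(f has_sum F) UNIV" using Suc by (simp add: f_def F_def)
  have s1: "((\<lambda>j. f (j - 1)) has_sum F) UNIV"
    using F by (subst has_sum_reindex_bij_witness[of _ "\<lambda>j. j + 1" "\<lambda>j. j - 1" UNIV f]) auto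
  have s2: "((\<lambda>j. f (j + 1)) has_sum F) UNIV"
    using F by (subst has_sum_reindex_bij_witness[of _ "\<lambda>j. j - 1" "\<lambda>j. j + 1" UNIV f]) auto
  have "((\<lambda>j. (1 + q ^ (4 * N + 2)) * f j + q ^ (2 * N + 1) * (w * f (j - 1) + f (j + 1) / w)) has_sum
     ((1 + q ^ (4 * N + 2)) * F + q ^ (2 * N + 1) * (w * F + F / w))) UNIV"
    using has_sum_cmult_left[OF s2, of "1 / w"]
    by (intro has_sum_add has_sum_cmult_right F s1) simp
  also have "(\<lambda>j. (1 + q ^ (4 * N + 2)) * f j + q ^ (2 * N + 1) * (w * f (j - 1) + f (j + 1) / w))
     = (\<lambda>j. central_qbinom (q\<^sup>2) (Suc N) j * q powi (j\<^sup>2) * w powi j)"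
    unfolding central_qbinom_step[OF q] f_def using w
    by (simp add: power_int_diff power_int_add field_simps)
  also have "(1 + q ^ (4 * N + 2)) * F + q ^ (2 * N + 1) * (w * F + F / w) = (\<Prod>k<Suc N. jacobi_factor q w k)"
  proof -
    have "q ^ (4 * N + 2) = q ^ (2 * N + 1) * q ^ (2 * N + 1)"
      unfolding power_add[symmetric] by (rule arg_cong[of _ _ "\<lambda>m. q ^ m"]) simp
    moreover have "(1 + x * x) * F + x * (w * F + F / w) = F * ((1 + x * w) * (1 + x / w))" for x
      using w by (simp add: field_simps)
    ultimately show ?thesis by (simp only: F_def jacobi_factor_def prod.lessThan_Suc)
  qed
  finally show ?case .
qed

section \<open>The passage to the infinite triple product\<close>

lemma convergent_prod_LIMSEQ_lessThan:
  fixes f :: "nat \<Rightarrow> complex"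
  shows "convergent_prod f \<Longrightarrow> (\<lambda>n. \<Prod>k<n. f k) \<longlonglongrightarrow> prodinf f"
  using convergent_prod_LIMSEQ by (simp add: LIMSEQ_lessThan_iff_atMost)

definition qpoch_inf :: "complex \<Rightarrow> complex" where
  "qpoch_inf p = prodinf (\<lambda>k. 1 - p ^ Suc k)"

lemma qpoch_convergent_prod:
  fixes p :: complex
  assumes "norm p < 1"
  shows "convergent_prod (\<lambda>k. 1 - p ^ Suc k)"
proof -
  have "summable (\<lambda>k. norm (- (p ^ Suc k)))"
    using summable_mult[OF summable_geometric[of "norm p"], of "norm p"] assms
    by (simp add: norm_power norm_mult summable_geometric summable_mult)
  then show ?thesis
    using summable_imp_convergent_prod_complex[of "\<lambda>k. - (p ^ Suc k)"] one_minus_power_nonzero[OF assms]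
    by (simp add: algebra_simps eq_neg_iff_add_eq_0)
qed

lemma qpoch_tendsto: "norm p < 1 \<Longrightarrow> qpoch p \<longlonglongrightarrow> qpoch_inf p"
  using convergent_prod_LIMSEQ_lessThan[OF qpoch_convergent_prod]
  unfolding qpoch_def[abs_def] qpoch_inf_def by blast

lemma qpoch_inf_nonzero: "norm p < 1 \<Longrightarrow> qpoch_inf p \<noteq> 0"
  unfolding qpoch_inf_def using qpoch_convergent_prod one_minus_power_nonzero prodinf_nonzero by blast

lemma inv_qpoch_tendsto:
  assumes p: "norm p < 1" and \<phi>: "filterlim \<phi> at_top sequentially"
  shows "(\<lambda>N. inv_qpoch p (\<phi> N)) \<longlonglongrightarrow> 1 / qpoch_inf p"
proof -
  have "filterlim (\<lambda>N. nat (\<phi> N)) at_top sequentially"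
    using filterlim_compose[OF filterlim_nat_sequentially \<phi>] by simp
  then have "(\<lambda>N. 1 / qpoch p (nat (\<phi> N))) \<longlonglongrightarrow> 1 / qpoch_inf p"
    using qpoch_tendsto[OF p] qpoch_inf_nonzero[OF p]
    by (intro tendsto_intros) (auto intro: filterlim_compose)
  moreover have "\<forall>\<^sub>F N in sequentially. 1 / qpoch p (nat (\<phi> N)) = inv_qpoch p (\<phi> N)"
    using \<phi>[unfolded filterlim_at_top, rule_format, of 0]
    by eventually_elim (auto simp: inv_qpoch_def)
  ultimately show ?thesis by (rule Lim_transform_eventually)
qed

lemma filterlim_int_add_const: "filterlim (\<lambda>N. int N + j) at_top sequentially"
  unfolding filterlim_at_top
proof
  fix Z :: int
  show "\<forall>\<^sub>F N in sequentially. Z \<le> int N + j"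
    using eventually_ge_at_top[of "nat (Z - j)"] by eventually_elim linarith
qed

lemma central_qbinom_tendsto:
  assumes p: "norm p < 1"
  shows "(\<lambda>N. central_qbinom p N j) \<longlonglongrightarrow> 1 / qpoch_inf p"
proof -
  have "(\<lambda>N. qpoch p (2 * N)) \<longlonglongrightarrow> qpoch_inf p"
    using LIMSEQ_subseq_LIMSEQ[OF qpoch_tendsto[OF p], of "\<lambda>N. 2 * N"]
    by (simp add: strict_mono_def o_def)
  moreover have "(\<lambda>N. inv_qpoch p (int N + j)) \<longlonglongrightarrow> 1 / qpoch_inf p"
    by (intro inv_qpoch_tendsto p filterlim_int_add_const)
  moreover have "(\<lambda>N. inv_qpoch p (int N - j)) \<longlonglongrightarrow> 1 / qpoch_inf p"
    using filterlim_int_add_const[of "- j"] by (intro inv_qpoch_tendsto p) simp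
  ultimately have "(\<lambda>N. central_qbinom p N j) \<longlonglongrightarrow> qpoch_inf p * (1 / qpoch_inf p) * (1 / qpoch_inf p)"
    unfolding central_qbinom_def by (intro tendsto_intros)
  then show ?thesis using qpoch_inf_nonzero[OF p] by simp
qed

lemma central_qbinom_bounded:
  assumes p: "norm p < 1"
  shows "\<exists>K. \<forall>N j. norm (central_qbinom p N j) \<le> K"
proof -
  obtain K1 where K1: "\<And>n. norm (qpoch p n) \<le> K1"
    using convergent_imp_Bseq[OF convergentI[OF qpoch_tendsto[OF p]]] by (auto simp: Bseq_def)
  have "(\<lambda>n. inv_qpoch p (int n)) \<longlonglongrightarrow> 1 / qpoch_inf p"
    using inv_qpoch_tendsto[OF p filterlim_int_add_const[of 0]] by simp
  then have "Bseq (\<lambda>n. inv_qpoch p (int n))" by (intro convergent_imp_Bseq convergentI)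
  then obtain K2 where K2: "K2 > 0" "\<And>n. norm (inv_qpoch p (int n)) \<le> K2"
    by (auto simp: Bseq_def)
  have K2': "norm (inv_qpoch p m) \<le> K2" for m
    using K2(2)[of "nat m"] K2(1) by (cases "m < 0") (auto simp: inv_qpoch_def)
  have "norm (central_qbinom p N j) \<le> K1 * K2 * K2" for N j
    unfolding central_qbinom_def norm_mult
  proof (intro mult_mono K1 K2')
    show "0 \<le> K1" by (rule order_trans[OF norm_ge_zero K1[of 0]])
  qed (use K2(1) order_trans[OF norm_ge_zero K1[of 0]] in \<open>simp_all add: mult_nonneg_nonneg\<close>)
  then show ?thesis by blast
qed

text \<open>
  The quadratic exponent wins against any geometric growth, because \<open>r ^ n\<^sup>2 * B ^ n = (r ^ n * B) ^ n\<close>.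
\<close>

lemma gaussian_summable_nat:
  fixes r B :: real
  assumes "0 \<le> r" "r < 1" "0 \<le> B"
  shows "summable (\<lambda>n. r ^ n\<^sup>2 * B ^ n)"
proof -
  have "(\<lambda>n. r ^ n * B) \<longlonglongrightarrow> 0 * B"
    using assms by (intro tendsto_intros LIMSEQ_power_zero) auto
  then have "\<forall>\<^sub>F n in sequentially. r ^ n * B < 1 / 2"
    by (rule order_tendstoD) auto
  then have "\<forall>\<^sub>F n in sequentially. norm (r ^ n\<^sup>2 * B ^ n) \<le> (1 / 2) ^ n"
  proof eventually_elim
    case (elim n)
    have "r ^ n\<^sup>2 * B ^ n = (r ^ n * B) ^ n"
      by (simp add: power_mult_distrib power2_eq_square power_mult)
    also have "\<dots> \<le> (1 / 2) ^ n" using elim assms by (intro power_mono) auto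
    finally show ?case using assms by simp
  qed
  then show ?thesis
    by (rule summable_comparison_test_ev) (simp add: summable_geometric)
qed

lemma gaussian_summable_int:
  fixes r B :: real
  assumes "0 \<le> r" "r < 1" "0 \<le> B"
  shows "(\<lambda>j::int. r ^ nat (j\<^sup>2) * B ^ nat \<bar>j\<bar>) summable_on UNIV"
proof -
  let ?f = "\<lambda>j::int. r ^ nat (j\<^sup>2) * B ^ nat \<bar>j\<bar>"
  have s: "(\<lambda>n. r ^ n\<^sup>2 * B ^ n) summable_on UNIV"
    using gaussian_summable_nat[OF assms] assms by (intro norm_summable_imp_summable_on) simp
  have n2: "nat ((int n)\<^sup>2) = n\<^sup>2" for n
    by (simp add: power2_eq_square nat_mult_distrib)
  have "?f summable_on range int" "?f summable_on range (\<lambda>n. - int n)"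
    using s by (subst summable_on_reindex; simp add: o_def n2 inj_on_def)+
  then have "?f summable_on range int \<union> range (\<lambda>n. - int n)" by (rule summable_on_union)
  also have "range int \<union> range (\<lambda>n. - int n) = UNIV"
  proof (intro set_eqI iffI UNIV_I)
    fix j :: int
    show "j \<in> range int \<union> range (\<lambda>n. - int n)" by (cases j rule: int_cases2) auto
  qed
  finally show ?thesis .
qed

text \<open>
  Tannery's theorem for sums over the integers, transferred along an enumeration of them.
\<close>

lemma dominated_convergence_infsum_int:
  fixes f :: "nat \<Rightarrow> int \<Rightarrow> real"
  assumes lim: "\<And>j. (\<lambda>N. f N j) \<longlonglongrightarrow> 0"
    and bound: "\<And>N j. norm (f N j) \<le> M j" and M: "M summable_on UNIV"
  shows "(\<lambda>N. \<Sum>\<^sub>\<infinity>j. f N j) \<longlonglongrightarrow> 0"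
proof -
  have bij: "bij_betw int_decode UNIV UNIV"
    using inj_int_decode surj_int_decode by (auto simp: bij_betw_def)
  have "(\<lambda>k. M (int_decode k)) summable_on UNIV"
    using M summable_on_reindex_bij_betw[OF bij, of M] by simp
  then have M': "summable (\<lambda>k. M (int_decode k))" by (rule summable_on_imp_summable)
  have "(\<lambda>N. suminf (\<lambda>k. f N (int_decode k))) \<longlonglongrightarrow> suminf (\<lambda>k. 0 :: real)"
  proof -
    have "\<forall>\<^sub>F (k, N) in at_top \<times>\<^sub>F sequentially. norm (f N (int_decode k)) \<le> M (int_decode k)"
      by (rule always_eventually) (use bound in auto)
    from tannerys_theorem[where b = "\<lambda>_. 0", OF lim this M' trivial_limit_sequentially]
    show ?thesis by blast
  qed
  moreover have "suminf (\<lambda>k. f N (int_decode k)) = (\<Sum>\<^sub>\<infinity>j. f N j)" for N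
  proof -
    have "summable (\<lambda>k. norm (f N (int_decode k)))"
      by (rule summable_comparison_test'[OF M']) (use bound in simp)
    note norm_summable_imp_has_sum[OF this summable_sums[OF summable_norm_cancel[OF this]]]
    from infsumI[OF this] show ?thesis
      using infsum_reindex_bij_betw[OF bij, of "f N"] by simp
  qed
  ultimately show ?thesis by simp
qed

lemma norm_power_int_le:
  fixes w :: complex
  assumes "norm w \<le> B" "norm (1 / w) \<le> B"
  shows "norm (w powi j) \<le> B ^ nat \<bar>j\<bar>"
proof (cases "j \<ge> 0")
  case True
  then show ?thesis using assms by (simp add: power_int_def norm_power power_mono)
next
  case False
  then show ?thesis using assms
    by (simp add: power_int_def norm_power norm_inverse power_mono norm_divide divide_inverse)
qed

text \<open>
  On an annulus \<open>1 / B \<le> norm w \<le> B\<close> the difference of the two sides is bounded by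
  \<open>\<Sum>j. norm (central_qbinom (q\<^sup>2) N j - 1 / qpoch_inf (q\<^sup>2)) * norm q ^ j\<^sup>2 * B ^ \<bar>j\<bar>\<close>. This bound is independent
  of \<open>w\<close> and tends to \<open>0\<close> by dominated convergence, which makes the convergence uniform.
\<close>

lemma triple_product_uniform_limit:
  assumes q: "norm q < 1" "q \<noteq> 0"
  shows "uniform_limit {w. w \<noteq> 0 \<and> norm w \<le> B \<and> norm (1 / w) \<le> B}
           (\<lambda>N w. \<Prod>k<N. jacobi_factor q w k)
           (\<lambda>w. (\<Sum>\<^sub>\<infinity>j::int. q powi (j\<^sup>2) * w powi j) / qpoch_inf (q\<^sup>2)) sequentially"
proof (cases "B \<ge> 0")
  case False
  then have "\<not> norm w \<le> B" for w :: complex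
    by (meson norm_ge_zero order_trans)
  then have empty: "{w::complex. w \<noteq> 0 \<and> norm w \<le> B \<and> norm (1 / w) \<le> B} = {}"
    by simp
  show ?thesis unfolding uniform_limit_iff empty by simp
next
  case B: True
  define p where "p = q\<^sup>2"
  define L where "L = 1 / qpoch_inf p"
  have p: "norm p < 1" using q by (auto simp: p_def norm_power power_less_one_iff)
  define M where "M = (\<lambda>j::int. norm q ^ nat (j\<^sup>2) * B ^ nat \<bar>j\<bar>)"
  have M: "M summable_on UNIV" "\<And>j. M j \<ge> 0"
    unfolding M_def using q B by (auto intro: gaussian_summable_int)
  obtain K where K: "\<And>N j. norm (central_qbinom p N j) \<le> K"
    using central_qbinom_bounded[OF p] by blast
  define D where "D = (\<lambda>N j. norm (central_qbinom p N j - L) * M j)"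
  have D_le: "norm (D N j) \<le> (K + norm L) * M j" for N j
    unfolding D_def using norm_triangle_ineq4[of "central_qbinom p N j" L] K[of N j] M(2)[of j]
    by (auto simp: abs_mult intro!: mult_right_mono)
  have KM: "(\<lambda>j. (K + norm L) * M j) summable_on UNIV" by (intro summable_on_cmult_right M)
  have D0: "(\<lambda>N. \<Sum>\<^sub>\<infinity>j. D N j) \<longlonglongrightarrow> 0"
  proof (rule dominated_convergence_infsum_int[OF _ D_le KM])
    fix j
    have "(\<lambda>N. norm (central_qbinom p N j - L) * M j) \<longlonglongrightarrow> norm (L - L) * M j"
      using central_qbinom_tendsto[OF p, of j] unfolding L_def by (intro tendsto_intros)
    then show "(\<lambda>N. D N j) \<longlonglongrightarrow> 0" by (simp add: D_def)
  qed
  have Ds: "D N summable_on UNIV" for N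
    using Infinite_Sum.abs_summable_on_comparison_test'[of "\<lambda>j. (K + norm L) * M j" UNIV "D N", OF KM] D_le by - (rule iffD2[OF summable_on_iff_abs_summable_on_real], simp)
  have main: "norm ((\<Prod>k<N. jacobi_factor q w k) - (\<Sum>\<^sub>\<infinity>j::int. q powi (j\<^sup>2) * w powi j) / qpoch_inf p)
      \<le> (\<Sum>\<^sub>\<infinity>j. D N j)" if w: "w \<noteq> 0" "norm w \<le> B" "norm (1 / w) \<le> B" for w N
  proof -
    have nq: "norm (q powi (j\<^sup>2)) = norm q ^ nat (j\<^sup>2)" for j :: int
      by (simp add: power_int_def norm_power)
    have le: "norm (q powi (j\<^sup>2) * w powi j) \<le> M j" for j
      unfolding M_def norm_mult nq using norm_power_int_le[OF w(2,3)] by (intro mult_left_mono) auto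
    have "(\<lambda>j::int. q powi (j\<^sup>2) * w powi j) summable_on UNIV"
      using Infinite_Sum.abs_summable_on_comparison_test'[of M UNIV "\<lambda>j. q powi (j\<^sup>2) * w powi j", OF M(1)] le by - (rule iffD2[OF summable_on_iff_abs_summable_on_complex], simp)
    then have "((\<lambda>j::int. q powi (j\<^sup>2) * w powi j) has_sum (\<Sum>\<^sub>\<infinity>j::int. q powi (j\<^sup>2) * w powi j)) UNIV"
      by (rule has_sum_infsum)
    from has_sum_add[OF finite_triple_product[OF q w(1), of N] has_sum_cmult_right[OF this, of "- L"]]
    have "((\<lambda>j. (central_qbinom p N j - L) * (q powi (j\<^sup>2) * w powi j)) has_sum
       ((\<Prod>k<N. jacobi_factor q w k) - L * (\<Sum>\<^sub>\<infinity>j::int. q powi (j\<^sup>2) * w powi j))) UNIV"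
      by (simp add: algebra_simps p_def)
    from norm_infsum_le[OF this has_sum_infsum[OF Ds[of N]]] show ?thesis
      using le unfolding D_def norm_mult L_def
      by (simp add: mult_left_mono)
  qed
  show ?thesis
    unfolding uniform_limit_iff p_def[symmetric]
  proof (intro allI impI)
    fix e :: real assume "e > 0"
    with D0 have "\<forall>\<^sub>F N in sequentially. (\<Sum>\<^sub>\<infinity>j. D N j) < e" by (rule order_tendstoD)
    then show "\<forall>\<^sub>F N in sequentially. \<forall>w\<in>{w. w \<noteq> 0 \<and> norm w \<le> B \<and> norm (1 / w) \<le> B}.
        dist (\<Prod>k<N. jacobi_factor q w k) ((\<Sum>\<^sub>\<infinity>j::int. q powi (j\<^sup>2) * w powi j) / qpoch_inf p) < e"
    proof eventually_elim
      case (elim N)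
      show ?case
        unfolding dist_norm by (intro ballI le_less_trans[OF main elim]) auto
    qed
  qed
qed

section \<open>Formal properties of theta functions with characteristics\<close>

abbreviation cexp :: "complex \<Rightarrow> complex" where
  "cexp x \<equiv> exp (2 * of_real pi * \<i> * x)"

lemma cexp_int [simp]: "cexp (of_int m) = 1"
  using exp_integer_2pi[of "of_int m"] by (simp add: mult_ac)

lemma cexp_add: "cexp (x + y) = cexp x * cexp y"
  by (simp add: exp_add[symmetric] ring_distribs)

lemma cexp_eq_iff: "cexp x = cexp y \<longleftrightarrow> (\<exists>m::int. x = y + of_int m)"
proof -
  have "2 * of_real pi * \<i> * x = 2 * of_real pi * \<i> * y + of_real (of_int (2 * m) * pi) * \<i>
      \<longleftrightarrow> x = y + of_int m" for m
  proof -
    have "2 * of_real pi * \<i> * y + of_real (of_int (2 * m) * pi) * \<i> = 2 * of_real pi * \<i> * (y + of_int m)"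
      by (simp add: ring_distribs mult_ac)
    then show ?thesis by (simp only: mult_cancel_left) simp
  qed
  then show ?thesis unfolding exp_eq by simp
qed

lemma cexp_cong: "(\<exists>m::int. x - y = of_int m) \<Longrightarrow> cexp x = cexp y"
  using cexp_eq_iff by (metis add.commute diff_add_cancel)

text \<open>
  Every theta function with characteristic is a translate of the one with characteristic \<open>[0, 0]\<close>, up to an
  exponential factor without zeros. Analytic statements therefore need to be proved for \<open>[0, 0]\<close> only.
\<close>

lemma theta_char_eq_theta_00:
  "theta_char \<epsilon> \<epsilon>' z \<tau> =
     cexp ((of_real \<epsilon>)\<^sup>2 * \<tau> / 8 + of_real \<epsilon> / 2 * (z + of_real \<epsilon>' / 2))
       * theta_char 0 0 (z + of_real \<epsilon>' / 2 + of_real \<epsilon> * \<tau> / 2) \<tau>"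
  unfolding theta_char_def infsum_cmult_right'[symmetric] exp_add[symmetric]
  by (intro infsum_cong arg_cong[of _ _ exp]) (simp add: field_simps power2_eq_square)

lemma theta_char_shift:
  "theta_char \<epsilon> \<epsilon>' (z + of_real t / 2) \<tau> = theta_char \<epsilon> (\<epsilon>' + t) z \<tau>"
  unfolding theta_char_def by (simp add: add_divide_distrib add_ac)

text \<open>
  Translation by \<open>\<tau>\<close> completes the square differently, so it amounts to a shift of the summation index.
\<close>

lemma theta_char_lattice:
  "theta_char \<epsilon> \<epsilon>' (z + of_int m + of_int n * \<tau>) \<tau> =
     cexp (of_int m * (of_real \<epsilon> / 2) + of_int n * (- of_real \<epsilon>' / 2)
           - ((of_int n)\<^sup>2 * \<tau> / 2 + of_int n * z)) * theta_char \<epsilon> \<epsilon>' z \<tau>"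
  unfolding theta_char_def infsum_cmult_right'[symmetric]
proof (rule infsum_reindex_bij_witness[of _ "\<lambda>k. k - n" "\<lambda>k. k + n"])
  fix k :: int
  show "cexp (of_int m * (of_real \<epsilon> / 2) + of_int n * (- of_real \<epsilon>' / 2) - ((of_int n)\<^sup>2 * \<tau> / 2 + of_int n * z))
     * cexp (1 / 2 * (of_int (k + n) + of_real \<epsilon> / 2)\<^sup>2 * \<tau> + (of_int (k + n) + of_real \<epsilon> / 2) * (z + of_real \<epsilon>' / 2))
     = cexp (1 / 2 * (of_int k + of_real \<epsilon> / 2)\<^sup>2 * \<tau>
         + (of_int k + of_real \<epsilon> / 2) * (z + of_int m + of_int n * \<tau> + of_real \<epsilon>' / 2))"
    unfolding cexp_add[symmetric]
    by (rule cexp_cong, rule exI[of _ "- (k * m)"]) (simp add: field_simps power2_eq_square)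
qed auto

lemma theta_char_minus: "theta_char \<epsilon> \<epsilon>' (- z) \<tau> = theta_char (- \<epsilon>) (- \<epsilon>') z \<tau>"
  unfolding theta_char_def
proof (rule infsum_reindex_bij_witness[of _ uminus uminus])
  fix k :: int
  show "cexp (1 / 2 * (of_int (- k) + of_real (- \<epsilon>) / 2)\<^sup>2 * \<tau> + (of_int (- k) + of_real (- \<epsilon>) / 2) * (z + of_real (- \<epsilon>') / 2))
     = cexp (1 / 2 * (of_int k + of_real \<epsilon> / 2)\<^sup>2 * \<tau> + (of_int k + of_real \<epsilon> / 2) * (- z + of_real \<epsilon>' / 2))"
    by (intro arg_cong[of _ _ exp]) (simp add: field_simps power2_eq_square)
qed auto

lemma theta_char_add_2: "theta_char (\<epsilon> + 2) \<epsilon>' z \<tau> = theta_char \<epsilon> \<epsilon>' z \<tau>"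
  unfolding theta_char_def
  by (rule infsum_reindex_bij_witness[of _ "\<lambda>k. k - 1" "\<lambda>k. k + 1"])
     (auto simp: add_divide_distrib add_ac)

section \<open>Holomorphy and zeros from the triple product\<close>

definition nome :: "complex \<Rightarrow> complex" where "nome \<tau> = exp (of_real pi * \<i> * \<tau>)"

lemma nome_nonzero: "nome \<tau> \<noteq> 0" by (simp add: nome_def)

lemma norm_nome_less_1: "Im \<tau> > 0 \<Longrightarrow> norm (nome \<tau>) < 1"
  by (simp add: nome_def norm_exp_eq_Re)

lemma norm_nome_sq_less_1: "Im \<tau> > 0 \<Longrightarrow> norm ((nome \<tau>)\<^sup>2) < 1"
  by (auto simp: norm_power power_less_one_iff norm_nome_less_1)

lemma theta_00_series:
  "theta_char 0 0 z \<tau> = (\<Sum>\<^sub>\<infinity>j::int. nome \<tau> powi (j\<^sup>2) * cexp z powi j)"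
  unfolding theta_char_def nome_def exp_power_int exp_add[symmetric]
  by (intro infsum_cong arg_cong[of _ _ exp]) (simp add: field_simps power2_eq_square)

definition jacobi_prod :: "complex \<Rightarrow> nat \<Rightarrow> complex \<Rightarrow> complex" where
  "jacobi_prod \<tau> N z = (\<Prod>k<N. jacobi_factor (nome \<tau>) (cexp z) k)"

lemma jacobi_prod_holomorphic: "jacobi_prod \<tau> N holomorphic_on UNIV"
  unfolding jacobi_prod_def[abs_def] jacobi_factor_def by (intro holomorphic_intros) auto

lemma jacobi_prod_uniform_limit:
  assumes "Im \<tau> > 0"
  shows "uniform_limit (cball z0 1) (jacobi_prod \<tau>)
           (\<lambda>z. theta_char 0 0 z \<tau> / qpoch_inf ((nome \<tau>)\<^sup>2)) sequentially"
proof -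
  define B where "B = exp (2 * pi * (\<bar>Im z0\<bar> + 1))"
  have B: "cexp z \<in> {w. w \<noteq> 0 \<and> norm w \<le> B \<and> norm (1 / w) \<le> B}" if "z \<in> cball z0 1" for z
  proof -
    have "\<bar>Im z0 - Im z\<bar> \<le> 1"
      using that abs_Im_le_cmod[of "z0 - z"] by (simp add: dist_norm)
    then have "- Im z \<le> \<bar>Im z0\<bar> + 1" "Im z \<le> \<bar>Im z0\<bar> + 1" by linarith+
    then have "2 * pi * (- Im z) \<le> 2 * pi * (\<bar>Im z0\<bar> + 1)" "2 * pi * Im z \<le> 2 * pi * (\<bar>Im z0\<bar> + 1)"
      by (intro mult_left_mono; simp)+
    then show ?thesis
      by (simp add: B_def norm_divide norm_exp_eq_Re exp_minus[symmetric] inverse_eq_divide[symmetric])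
  qed
  show ?thesis
    using uniform_limit_compose'[OF triple_product_uniform_limit[OF norm_nome_less_1[OF assms] nome_nonzero, of B], of cexp "cball z0 1"] B
    unfolding jacobi_prod_def[abs_def] theta_00_series by auto
qed

text \<open>
  Locally uniform convergence of holomorphic functions gives at once the holomorphy of the limit and the
  convergence of the derivatives. The latter makes values of \<open>\<theta>'\<close> at zeros of \<open>\<theta>\<close> computable from finite products.
\<close>

lemma jacobi_prod_limits:
  assumes "Im \<tau> > 0"
  shows theta_00_field_differentiable: "(\<lambda>z. theta_char 0 0 z \<tau>) field_differentiable at z"
    and jacobi_prod_tendsto:
      "(\<lambda>N. jacobi_prod \<tau> N z) \<longlonglongrightarrow> theta_char 0 0 z \<tau> / qpoch_inf ((nome \<tau>)\<^sup>2)"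
    and deriv_jacobi_prod_tendsto:
      "(\<lambda>N. deriv (jacobi_prod \<tau> N) z) \<longlonglongrightarrow> deriv (\<lambda>z. theta_char 0 0 z \<tau>) z / qpoch_inf ((nome \<tau>)\<^sup>2)"
proof -
  define L where "L = qpoch_inf ((nome \<tau>)\<^sup>2)"
  have L: "L \<noteq> 0" unfolding L_def using qpoch_inf_nonzero norm_nome_sq_less_1[OF assms] by blast
  show "(\<lambda>N. jacobi_prod \<tau> N z) \<longlonglongrightarrow> theta_char 0 0 z \<tau> / qpoch_inf ((nome \<tau>)\<^sup>2)"
    by (rule tendsto_uniform_limitI[OF jacobi_prod_uniform_limit[OF assms, of z]]) simp
  have "\<exists>g'. \<forall>x\<in>UNIV. ((\<lambda>z. theta_char 0 0 z \<tau> / L) has_field_derivative g' x) (at x)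
          \<and> (\<lambda>N. deriv (jacobi_prod \<tau> N) x) \<longlonglongrightarrow> g' x"
  proof (rule has_complex_derivative_uniform_sequence)
    show "(jacobi_prod \<tau> N has_field_derivative deriv (jacobi_prod \<tau> N) x) (at x)" for N x
      using holomorphic_derivI[OF jacobi_prod_holomorphic] by auto
    show "\<exists>d. 0 < d \<and> cball x d \<subseteq> UNIV \<and>
        uniform_limit (cball x d) (jacobi_prod \<tau>) (\<lambda>z. theta_char 0 0 z \<tau> / L) sequentially" for x
      using jacobi_prod_uniform_limit[OF assms, of x] unfolding L_def by (intro exI[of _ 1]) auto
  qed auto
  then obtain g' where g': "((\<lambda>z. theta_char 0 0 z \<tau> / L) has_field_derivative g' z) (at z)"
      "(\<lambda>N. deriv (jacobi_prod \<tau> N) z) \<longlonglongrightarrow> g' z" by blast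
  have d: "((\<lambda>z. theta_char 0 0 z \<tau>) has_field_derivative L * g' z) (at z)"
    using DERIV_cmult[OF g'(1), of L] L by simp
  then show "(\<lambda>z. theta_char 0 0 z \<tau>) field_differentiable at z"
    by (auto simp: field_differentiable_def)
  show "(\<lambda>N. deriv (jacobi_prod \<tau> N) z) \<longlonglongrightarrow> deriv (\<lambda>z. theta_char 0 0 z \<tau>) z / qpoch_inf ((nome \<tau>)\<^sup>2)"
    using g'(2) L DERIV_imp_deriv[OF d] by (simp add: L_def)
qed

lemma theta_char_holomorphic:
  assumes "Im \<tau> > 0"
  shows "(\<lambda>z. theta_char \<epsilon> \<epsilon>' z \<tau>) holomorphic_on A"
proof -
  have "(\<lambda>z. theta_char 0 0 z \<tau>) holomorphic_on UNIV"
    using theta_00_field_differentiable[OF assms] by (simp add: holomorphic_on_def)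
  then have "(\<lambda>z. theta_char 0 0 z \<tau>) \<circ> (\<lambda>z. z + of_real \<epsilon>' / 2 + of_real \<epsilon> * \<tau> / 2) holomorphic_on A"
    by (intro holomorphic_on_compose_gen[of _ A _ UNIV] holomorphic_intros) auto
  then show ?thesis
    unfolding theta_char_eq_theta_00[of \<epsilon> \<epsilon>'] o_def by (intro holomorphic_intros)
qed

lemma convergent_prod_one_plus_odd_powers:
  fixes q c :: complex
  assumes q: "norm q < 1" and nz: "\<And>k. 1 + q ^ (2 * k + 1) * c \<noteq> 0"
  shows "convergent_prod (\<lambda>k. 1 + q ^ (2 * k + 1) * c)"
proof (rule summable_imp_convergent_prod_complex)
  have "norm (q ^ (2 * k + 1) * c) = norm q * norm c * (norm q ^ 2) ^ k" for k
    by (simp add: norm_mult norm_power power_mult)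
  moreover have "summable (\<lambda>k. norm q * norm c * (norm q ^ 2) ^ k)"
    using q by (intro summable_mult summable_geometric) (auto simp: power_less_one_iff)
  ultimately show "summable (\<lambda>k. norm (q ^ (2 * k + 1) * c))" by simp
  show "q ^ (2 * k + 1) * c \<noteq> - 1" for k using nz[of k] by (metis add.commute add.left_inverse add.right_inverse)
qed

text \<open>
  If no Jacobi factor vanishes at \<open>z\<close>, then the infinite product converges to a non-zero number. Hence a zero
  of \<open>\<theta>\<close> is a zero of one of the factors \<open>1 + q ^ (2 * k + 1) * w\<close> or \<open>1 + q ^ (2 * k + 1) / w\<close>, where \<open>w = cexp z\<close>.
\<close>

lemma theta_00_zero_imp:
  assumes \<tau>: "Im \<tau> > 0" and zero: "theta_char 0 0 z \<tau> = 0"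
  shows "\<exists>m n::int. z = (1 + \<tau>) / 2 + of_int m + of_int n * \<tau>"
proof -
  define q where "q = nome \<tau>"
  have q: "norm q < 1" unfolding q_def by (rule norm_nome_less_1[OF \<tau>])
  have "\<exists>k. 1 + q ^ (2 * k + 1) * cexp z = 0 \<or> 1 + q ^ (2 * k + 1) * (1 / cexp z) = 0"
  proof (rule ccontr)
    assume "\<not> ?thesis"
    then have nz: "1 + q ^ (2 * k + 1) * cexp z \<noteq> 0" "1 + q ^ (2 * k + 1) * (1 / cexp z) \<noteq> 0" for k
      by blast+
    note c = convergent_prod_one_plus_odd_powers[OF q nz(1)] convergent_prod_one_plus_odd_powers[OF q nz(2)]
    have "jacobi_prod \<tau> N z = (\<Prod>k<N. 1 + q ^ (2 * k + 1) * cexp z) * (\<Prod>k<N. 1 + q ^ (2 * k + 1) * (1 / cexp z))" for N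
      by (simp add: jacobi_prod_def jacobi_factor_def q_def prod.distrib)
    then have "(\<lambda>N. jacobi_prod \<tau> N z) \<longlonglongrightarrow>
        prodinf (\<lambda>k. 1 + q ^ (2 * k + 1) * cexp z) * prodinf (\<lambda>k. 1 + q ^ (2 * k + 1) * (1 / cexp z))"
      using c[THEN convergent_prod_LIMSEQ_lessThan] by (simp only:) (intro tendsto_intros)
    moreover have "(\<lambda>N. jacobi_prod \<tau> N z) \<longlonglongrightarrow> 0"
      using jacobi_prod_tendsto[OF \<tau>, of z] zero by simp
    ultimately have "prodinf (\<lambda>k. 1 + q ^ (2 * k + 1) * cexp z) * prodinf (\<lambda>k. 1 + q ^ (2 * k + 1) * (1 / cexp z)) = 0"
      using LIMSEQ_unique by blast
    then show False using prodinf_nonzero[OF c(1) nz(1)] prodinf_nonzero[OF c(2) nz(2)] by simp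
  qed
  then obtain k where k: "1 + q ^ (2 * k + 1) * cexp z = 0 \<or> 1 + q ^ (2 * k + 1) * (1 / cexp z) = 0" by blast
  have qk: "q ^ (2 * k + 1) = cexp ((2 * of_nat k + 1) * \<tau> / 2)"
    unfolding q_def nome_def exp_of_nat_mult[symmetric] by (intro arg_cong[of _ _ exp]) (simp add: field_simps)
  have half: "cexp (1 / 2) = - 1" by simp
  from k show ?thesis
  proof
    assume "1 + q ^ (2 * k + 1) * cexp z = 0"
    then have "cexp ((2 * of_nat k + 1) * \<tau> / 2 + z) = cexp (1 / 2)"
      unfolding cexp_add half qk by (simp add: eq_neg_iff_add_eq_0 add.commute)
    then obtain m :: int where "(2 * of_nat k + 1) * \<tau> / 2 + z = 1 / 2 + of_int m"
      unfolding cexp_eq_iff by blast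
    then have "z = 1 / 2 + of_int m - (2 * of_nat k + 1) * \<tau> / 2" by (metis add_diff_cancel_left')
    also have "\<dots> = (1 + \<tau>) / 2 + of_int m + of_int (- int k - 1) * \<tau>" by (simp add: field_simps)
    finally have "z = (1 + \<tau>) / 2 + of_int m + of_int (- int k - 1) * \<tau>" .
    then show ?thesis by blast
  next
    assume "1 + q ^ (2 * k + 1) * (1 / cexp z) = 0"
    then have "cexp ((2 * of_nat k + 1) * \<tau> / 2) = cexp (1 / 2 + z)"
      unfolding cexp_add half qk by (simp add: field_simps add_eq_0_iff)
    then obtain m :: int where "(2 * of_nat k + 1) * \<tau> / 2 = 1 / 2 + z + of_int m"
      unfolding cexp_eq_iff by blast
    then have "z = (2 * of_nat k + 1) * \<tau> / 2 - 1 / 2 - of_int m" by (metis add_diff_cancel_left' add.assoc diff_diff_eq add_diff_cancel_right')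
    also have "\<dots> = (1 + \<tau>) / 2 + of_int (- m - 1) + of_int (int k) * \<tau>" by (simp add: field_simps)
    finally have "z = (1 + \<tau>) / 2 + of_int (- m - 1) + of_int (int k) * \<tau>" .
    then show ?thesis by blast
  qed
qed

text \<open>
  At \<open>z = (1 + \<tau>) / 2\<close>, where \<open>cexp z = - q\<close>, the only vanishing factor is \<open>1 + q / cexp z\<close>. The derivative
  of the finite product there is the derivative of this factor times the product of all others, and the
  latter consists of factors \<open>1 - q ^ (2 * k)\<close>.
\<close>

lemma deriv_theta_00_zero:
  assumes \<tau>: "Im \<tau> > 0"
  shows "deriv (\<lambda>z. theta_char 0 0 z \<tau>) ((1 + \<tau>) / 2) = 2 * of_real pi * \<i> * qpoch_inf ((nome \<tau>)\<^sup>2) ^ 3"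
proof -
  define q p L z0 where "q = nome \<tau>" and "p = q\<^sup>2" and "L = qpoch_inf p" and "z0 = (1 + \<tau>) / 2"
  have p: "norm p < 1" unfolding p_def q_def by (rule norm_nome_sq_less_1[OF \<tau>])
  have L: "L \<noteq> 0" unfolding L_def using p by (rule qpoch_inf_nonzero)
  have q: "q \<noteq> 0" by (simp add: q_def nome_nonzero)
  have w: "cexp z0 = - q"
    unfolding z0_def q_def nome_def by (simp add: add_divide_distrib ring_distribs exp_add mult.assoc)
  have d: "deriv (jacobi_prod \<tau> (Suc N)) z0 = 2 * of_real pi * \<i> * (qpoch p (Suc N) * qpoch p N)" for N
  proof -
    define R where "R = (\<lambda>z. (1 + q * cexp z) * (\<Prod>k<N. jacobi_factor q (cexp z) (Suc k)))"
    have "jacobi_prod \<tau> (Suc N) = (\<lambda>z. (1 + q / cexp z) * R z)"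
      unfolding jacobi_prod_def R_def prod.lessThan_Suc_shift q_def[symmetric]
      by (simp add: jacobi_factor_def mult_ac)
    moreover have "(R has_field_derivative deriv R z0) (at z0)"
      unfolding R_def jacobi_factor_def
      by (rule holomorphic_derivI[of _ UNIV]) (auto intro!: holomorphic_intros)
    then have "((\<lambda>z. (1 + q / cexp z) * R z) has_field_derivative
        (1 + q / cexp z0) * deriv R z0 + (- 2 * of_real pi * \<i> * q / cexp z0) * R z0) (at z0)"
      by (auto intro!: derivative_eq_intros simp: field_simps power2_eq_square)
    ultimately have "deriv (jacobi_prod \<tau> (Suc N)) z0
        = (1 + q / cexp z0) * deriv R z0 + (- 2 * of_real pi * \<i> * q / cexp z0) * R z0"
      using DERIV_imp_deriv by metis
    also have "\<dots> = 2 * of_real pi * \<i> * R z0"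
      using q unfolding w by simp
    also have "R z0 = (1 - p ^ Suc 0) * (\<Prod>k<N. (1 - p ^ Suc (Suc k)) * (1 - p ^ Suc k))"
    proof -
      have "jacobi_factor q (- q) (Suc k) = (1 - p ^ Suc (Suc k)) * (1 - p ^ Suc k)" for k
        using q by (simp add: jacobi_factor_def p_def power_mult power2_eq_square power_mult_distrib mult_ac)
      then show ?thesis unfolding R_def w by (simp add: p_def power2_eq_square)
    qed
    also have "\<dots> = qpoch p (Suc N) * qpoch p N"
      unfolding qpoch_def prod.lessThan_Suc_shift[of _ N] prod.distrib by (simp add: mult_ac)
    finally show ?thesis .
  qed
  have "(\<lambda>N. 2 * of_real pi * \<i> * (qpoch p (Suc N) * qpoch p N)) \<longlonglongrightarrow> 2 * of_real pi * \<i> * (L * L)"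
    unfolding L_def using qpoch_tendsto[OF p] by (intro tendsto_intros LIMSEQ_Suc)
  moreover have "(\<lambda>N. 2 * of_real pi * \<i> * (qpoch p (Suc N) * qpoch p N)) \<longlonglongrightarrow>
      deriv (\<lambda>z. theta_char 0 0 z \<tau>) z0 / L"
    using LIMSEQ_Suc[OF deriv_jacobi_prod_tendsto[OF \<tau>, of z0]] unfolding d L_def p_def q_def .
  ultimately have "deriv (\<lambda>z. theta_char 0 0 z \<tau>) z0 / L = 2 * of_real pi * \<i> * (L * L)"
    using LIMSEQ_unique by blast
  then show ?thesis using L unfolding L_def p_def q_def z0_def
    by (simp add: field_simps power3_eq_cube)
qed

section \<open>The derivative formula of Jacobi\<close>

text \<open>
  A finite form of Euler's identity \<open>\<Prod>(1 + q ^ k) (1 - q ^ (2 k - 1)) = 1\<close>. Here the product of the three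
  displayed products is \<open>qpoch (q\<^sup>2) (2 * N) / qpoch (q\<^sup>2) N\<close>, which tends to \<open>1\<close>.
\<close>

lemma euler_product_identity:
  fixes q :: complex
  shows "(\<Prod>k<N. 1 + q ^ (2 * k + 1)) * (\<Prod>k<N. 1 - q ^ (2 * k + 1)) * (\<Prod>k<N. 1 + (q\<^sup>2) ^ Suc k)
           * qpoch (q\<^sup>2) N = qpoch (q\<^sup>2) (2 * N)"
proof (induction N)
  case 0
  then show ?case by (simp add: qpoch_def)
next
  case (Suc N)
  have "(1 + q ^ (2 * N + 1)) * (1 - q ^ (2 * N + 1)) = 1 - (q\<^sup>2) ^ Suc (2 * N)"
    by (simp add: algebra_simps flip: power_mult power_add power_Suc power2_eq_square)
  moreover have "(1 + (q\<^sup>2) ^ Suc N) * (1 - (q\<^sup>2) ^ Suc N) = 1 - (q\<^sup>2) ^ Suc (Suc (2 * N))"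
    by (simp add: algebra_simps flip: power_mult power_add power_Suc power2_eq_square)
  moreover have "a * x * (b * y) * (c * z) * (d * t) = a * b * c * d * (x * y) * (z * t)" for a b c d x y z t :: complex
    by (simp add: mult_ac)
  moreover have "qpoch (q\<^sup>2) (2 * Suc N) = qpoch (q\<^sup>2) (2 * N) * (1 - (q\<^sup>2) ^ Suc (2 * N)) * (1 - (q\<^sup>2) ^ Suc (Suc (2 * N)))"
    by (simp add: qpoch_def)
  ultimately show ?case
    using Suc unfolding qpoch_def prod.lessThan_Suc by (simp only:)
qed

text \<open>
  By the triple product the three values are, up to \<open>qpoch_inf (q\<^sup>2)\<close>, the squares of the three products in
  Euler's identity, and the factor \<open>1 + q ^ 0\<close> at \<open>\<tau> / 2\<close> contributes the \<open>2\<close>.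
\<close>

lemma theta_00_half_periods_product:
  assumes \<tau>: "Im \<tau> > 0"
  shows "theta_char 0 0 0 \<tau> * theta_char 0 0 (1 / 2) \<tau> * theta_char 0 0 (\<tau> / 2) \<tau>
           = 2 * qpoch_inf ((nome \<tau>)\<^sup>2) ^ 3"
proof -
  define q p L where "q = nome \<tau>" and "p = q\<^sup>2" and "L = qpoch_inf p"
  have p: "norm p < 1" unfolding p_def q_def by (rule norm_nome_sq_less_1[OF \<tau>])
  have L: "L \<noteq> 0" unfolding L_def using p by (rule qpoch_inf_nonzero)
  have q: "q \<noteq> 0" by (simp add: q_def nome_nonzero)
  define a b c where "a = (\<lambda>N. \<Prod>k<N. 1 + q ^ (2 * k + 1))" and "b = (\<lambda>N. \<Prod>k<N. 1 - q ^ (2 * k + 1))"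
    and "c = (\<lambda>N. \<Prod>k<N. 1 + p ^ Suc k)"
  have A: "jacobi_prod \<tau> N 0 = (a N)\<^sup>2" for N
    by (simp add: jacobi_prod_def jacobi_factor_def a_def q_def prod.distrib power2_eq_square)
  have B: "jacobi_prod \<tau> N (1 / 2) = (b N)\<^sup>2" for N
    by (simp add: jacobi_prod_def jacobi_factor_def b_def q_def prod.distrib power2_eq_square)
  have w: "cexp (\<tau> / 2) = q" by (simp add: q_def nome_def mult.assoc)
  have C: "jacobi_prod \<tau> N (\<tau> / 2) * (1 + p ^ N) = 2 * (c N)\<^sup>2" for N
  proof -
    have "jacobi_factor q q k = (1 + p ^ Suc k) * (1 + p ^ k)" for k
      using q by (simp add: jacobi_factor_def p_def power_mult power2_eq_square power_mult_distrib mult_ac)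
    then have "jacobi_prod \<tau> N (\<tau> / 2) = c N * (\<Prod>k<N. 1 + p ^ k)"
      by (simp only: jacobi_prod_def w q_def[symmetric] prod.distrib c_def)
    moreover have "(\<Prod>k<N. 1 + p ^ k) * (1 + p ^ N) = 2 * c N"
    proof -
      have "(\<Prod>k<N. 1 + p ^ k) * (1 + p ^ N) = (\<Prod>k<Suc N. 1 + p ^ k)" by simp
      also have "\<dots> = 2 * c N" unfolding prod.lessThan_Suc_shift c_def by simp
      finally show ?thesis .
    qed
    ultimately show ?thesis by (simp add: power2_eq_square algebra_simps)
  qed
  have abc: "a N * b N * c N = qpoch p (2 * N) / qpoch p N" for N
    using euler_product_identity[of q N] qpoch_nonzero[OF p, of N]
    by (simp add: a_def b_def c_def p_def field_simps)
  have "(\<lambda>N. qpoch p (2 * N)) \<longlonglongrightarrow> L"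
    using LIMSEQ_subseq_LIMSEQ[OF qpoch_tendsto[OF p], of "\<lambda>N. 2 * N"]
    by (simp add: strict_mono_def o_def L_def)
  then have lim2: "(\<lambda>N. 2 * (a N * b N * c N)\<^sup>2) \<longlonglongrightarrow> 2 * (L / L)\<^sup>2"
    unfolding abc using qpoch_tendsto[OF p] L by (intro tendsto_intros) (auto simp: L_def)
  have lim1: "(\<lambda>N. jacobi_prod \<tau> N 0 * jacobi_prod \<tau> N (1 / 2) * (jacobi_prod \<tau> N (\<tau> / 2) * (1 + p ^ N)))
      \<longlonglongrightarrow> theta_char 0 0 0 \<tau> / L * (theta_char 0 0 (1 / 2) \<tau> / L) * (theta_char 0 0 (\<tau> / 2) \<tau> / L * (1 + 0))"
    unfolding L_def p_def q_def
    by (intro tendsto_intros jacobi_prod_tendsto[OF \<tau>] LIMSEQ_power_zero norm_nome_sq_less_1[OF \<tau>])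
  have eq: "jacobi_prod \<tau> N 0 * jacobi_prod \<tau> N (1 / 2) * (jacobi_prod \<tau> N (\<tau> / 2) * (1 + p ^ N))
      = 2 * (a N * b N * c N)\<^sup>2" for N
    unfolding A B C by (simp add: power_mult_distrib mult_ac)
  have "theta_char 0 0 0 \<tau> / L * (theta_char 0 0 (1 / 2) \<tau> / L) * (theta_char 0 0 (\<tau> / 2) \<tau> / L * (1 + 0))
      = 2 * (L / L)\<^sup>2"
    by (rule LIMSEQ_unique[OF lim1[unfolded eq] lim2])
  then show ?thesis using L unfolding L_def p_def q_def
    by (simp add: field_simps power3_eq_cube)
qed

text \<open>
  Both sides are multiples of the cube of \<open>qpoch_inf (q\<^sup>2)\<close>: the left-hand side because \<open>\<theta>\<^sub>1\<^sub>1\<close> is a multiple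
  of \<open>\<theta>\<^sub>0\<^sub>0\<close> translated to its zero \<open>(1 + \<tau>) / 2\<close>, the right-hand side because the three constants are multiples
  of values of \<open>\<theta>\<^sub>0\<^sub>0\<close> at the other half periods.
\<close>

lemma jacobi_derivative_formula:
  assumes \<tau>: "Im \<tau> > 0"
  shows "deriv (\<lambda>z. theta_char 1 1 z \<tau>) 0
     = - of_real pi * theta_char 0 0 0 \<tau> * theta_char 0 1 0 \<tau> * theta_char 1 0 0 \<tau>"
proof -
  define L where "L = qpoch_inf ((nome \<tau>)\<^sup>2)"
  define T where "T = (\<lambda>z. theta_char 0 0 z \<tau>)"
  define E where "E = (\<lambda>z. cexp (\<tau> / 8 + 1 / 2 * (z + 1 / 2)))"
  have T11: "theta_char 1 1 z \<tau> = E z * T ((1 + \<tau>) / 2 + z)" for z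
    using theta_char_eq_theta_00[of 1 1 z \<tau>] by (simp add: E_def T_def add_divide_distrib add_ac)
  have T0: "T ((1 + \<tau>) / 2) = 0"
  proof -
    have *: "(1 + \<tau>) / 2 = - ((1 + \<tau>) / 2) + of_int 1 + of_int 1 * \<tau>" by (simp add: field_simps)
    have "T ((1 + \<tau>) / 2) = cexp (- (\<tau> / 2 + - ((1 + \<tau>) / 2))) * T (- ((1 + \<tau>) / 2))"
      unfolding T_def by (subst *, subst theta_char_lattice) simp
    also have "cexp (- (\<tau> / 2 + - ((1 + \<tau>) / 2))) = - 1" by (simp add: field_simps)
    also have "T (- ((1 + \<tau>) / 2)) = T ((1 + \<tau>) / 2)"
      unfolding T_def by (subst theta_char_minus) simp
    finally show ?thesis by simp
  qed
  have dT: "(T has_field_derivative 2 * of_real pi * \<i> * L ^ 3) (at ((1 + \<tau>) / 2))"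
    using field_differentiable_derivI[OF theta_00_field_differentiable[OF \<tau>]] deriv_theta_00_zero[OF \<tau>]
    unfolding T_def L_def by metis
  have "((\<lambda>z. E z * T ((1 + \<tau>) / 2 + z)) has_field_derivative
      E 0 * (2 * of_real pi * \<i> * L ^ 3) + deriv E 0 * T ((1 + \<tau>) / 2 + 0)) (at 0)"
  proof (rule DERIV_mult')
    show "(E has_field_derivative deriv E 0) (at 0)"
      unfolding E_def by (rule holomorphic_derivI[of _ UNIV]) (auto intro!: holomorphic_intros)
    show "((\<lambda>z. T ((1 + \<tau>) / 2 + z)) has_field_derivative 2 * of_real pi * \<i> * L ^ 3) (at 0)"
      using dT DERIV_shift[of T "2 * of_real pi * \<i> * L ^ 3" 0 "(1 + \<tau>) / 2"]
      by (simp add: add.commute)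
  qed
  then have D: "deriv (\<lambda>z. theta_char 1 1 z \<tau>) 0 = E 0 * (2 * of_real pi * \<i> * L ^ 3)"
    unfolding T11 using T0 DERIV_imp_deriv by fastforce
  have "cexp (1 / 4) = \<i>" by (simp add: exp_eq_polar cis_conv_exp[symmetric])
  moreover have "E 0 = cexp (\<tau> / 8 + 1 / 4)" by (simp add: E_def)
  ultimately have E0: "E 0 = cexp (\<tau> / 8) * \<i>" unfolding cexp_add by (simp only:)
  have "theta_char 0 1 0 \<tau> = T (1 / 2)" "theta_char 1 0 0 \<tau> = cexp (\<tau> / 8) * T (\<tau> / 2)"
    using theta_char_eq_theta_00[of 0 1 0 \<tau>] theta_char_eq_theta_00[of 1 0 0 \<tau>] by (simp_all add: T_def)
  then have "- of_real pi * theta_char 0 0 0 \<tau> * theta_char 0 1 0 \<tau> * theta_char 1 0 0 \<tau>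
      = - of_real pi * cexp (\<tau> / 8) * (theta_char 0 0 0 \<tau> * theta_char 0 0 (1 / 2) \<tau> * theta_char 0 0 (\<tau> / 2) \<tau>)"
    by (simp add: T_def)
  also have "\<dots> = deriv (\<lambda>z. theta_char 1 1 z \<tau>) 0"
    unfolding D E0 theta_00_half_periods_product[OF \<tau>] L_def by (simp add: algebra_simps)
  finally show "deriv (\<lambda>z. theta_char 1 1 z \<tau>) 0
     = - of_real pi * theta_char 0 0 0 \<tau> * theta_char 0 1 0 \<tau> * theta_char 1 0 0 \<tau>" ..
qed

section \<open>Quasi-periodic entire functions\<close>

text \<open>
  The factors of a theta function of order \<open>k\<close>, with \<open>\<alpha>\<close> and \<open>\<beta>\<close> recording the characteristic: under a product,
  orders and characteristics add. The whole lattice is treated at once, so that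
  zeros and values can be transported along it without induction over the two generators.
\<close>

definition quasi_periodic :: "complex \<Rightarrow> nat \<Rightarrow> complex \<Rightarrow> complex \<Rightarrow> (complex \<Rightarrow> complex) \<Rightarrow> bool" where
  "quasi_periodic \<tau> k \<alpha> \<beta> f \<longleftrightarrow> (\<forall>(m::int) (n::int) z.
     f (z + of_int m + of_int n * \<tau>) =
       cexp (of_int m * \<alpha> + of_int n * \<beta> - of_nat k * ((of_int n)\<^sup>2 * \<tau> / 2 + of_int n * z)) * f z)"

lemma quasi_periodicD:
  "quasi_periodic \<tau> k \<alpha> \<beta> f \<Longrightarrow> f (z + of_int m + of_int n * \<tau>) =
     cexp (of_int m * \<alpha> + of_int n * \<beta> - of_nat k * ((of_int n)\<^sup>2 * \<tau> / 2 + of_int n * z)) * f z"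
  unfolding quasi_periodic_def by blast

lemma quasi_periodic_theta:
  "quasi_periodic \<tau> 1 (of_real \<epsilon> / 2) (- of_real \<epsilon>' / 2) (\<lambda>z. theta_char \<epsilon> \<epsilon>' z \<tau>)"
  unfolding quasi_periodic_def using theta_char_lattice by simp

lemma quasi_periodic_mult:
  assumes "quasi_periodic \<tau> k \<alpha> \<beta> f" "quasi_periodic \<tau> l \<gamma> \<delta> g"
  shows "quasi_periodic \<tau> (k + l) (\<alpha> + \<gamma>) (\<beta> + \<delta>) (\<lambda>z. f z * g z)"
  unfolding quasi_periodic_def
proof (intro allI)
  fix m n :: int and z
  have "cexp (of_int m * (\<alpha> + \<gamma>) + of_int n * (\<beta> + \<delta>) - of_nat (k + l) * ((of_int n)\<^sup>2 * \<tau> / 2 + of_int n * z))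
      = cexp (of_int m * \<alpha> + of_int n * \<beta> - of_nat k * ((of_int n)\<^sup>2 * \<tau> / 2 + of_int n * z))
      * cexp (of_int m * \<gamma> + of_int n * \<delta> - of_nat l * ((of_int n)\<^sup>2 * \<tau> / 2 + of_int n * z))"
    unfolding cexp_add[symmetric] by (rule arg_cong[of _ _ cexp]) (simp add: algebra_simps)
  then show "f (z + of_int m + of_int n * \<tau>) * g (z + of_int m + of_int n * \<tau>) =
     cexp (of_int m * (\<alpha> + \<gamma>) + of_int n * (\<beta> + \<delta>) - of_nat (k + l) * ((of_int n)\<^sup>2 * \<tau> / 2 + of_int n * z)) * (f z * g z)"
    unfolding assms[THEN quasi_periodicD] by (simp only: mult_ac)
qed

lemma quasi_periodic_power3:
  assumes "quasi_periodic \<tau> k \<alpha> \<beta> f"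
  shows "quasi_periodic \<tau> (3 * k) (3 * \<alpha>) (3 * \<beta>) (\<lambda>z. f z ^ 3)"
proof -
  have "3 * k = k + (k + k)" "3 * \<alpha> = \<alpha> + (\<alpha> + \<alpha>)" "3 * \<beta> = \<beta> + (\<beta> + \<beta>)" by simp_all
  then show ?thesis
    using quasi_periodic_mult[OF assms quasi_periodic_mult[OF assms assms]]
    by (simp only: power3_eq_cube mult.assoc)
qed

lemma quasi_periodic_add:
  assumes "quasi_periodic \<tau> k \<alpha> \<beta> f" "quasi_periodic \<tau> k \<alpha> \<beta> g"
  shows "quasi_periodic \<tau> k \<alpha> \<beta> (\<lambda>z. f z + g z)"
  unfolding quasi_periodic_def by (simp only: assms[THEN quasi_periodicD] ring_distribs simp_thms)

lemma quasi_periodic_characteristic_cong: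
  assumes "quasi_periodic \<tau> k \<alpha> \<beta> f" and "\<gamma> = \<alpha> + of_int a" "\<delta> = \<beta> + of_int b"
  shows "quasi_periodic \<tau> k \<gamma> \<delta> f"
proof -
  have "cexp (of_int m * \<alpha> + of_int n * \<beta> - of_nat k * ((of_int n)\<^sup>2 * \<tau> / 2 + of_int n * z))
      = cexp (of_int m * \<gamma> + of_int n * \<delta> - of_nat k * ((of_int n)\<^sup>2 * \<tau> / 2 + of_int n * z))"
    for m n :: int and z
    by (rule cexp_cong, rule exI[of _ "- (m * a + n * b)"]) (simp add: assms(2,3) algebra_simps)
  then show ?thesis
    unfolding quasi_periodic_def quasi_periodicD[OF assms(1)] by (intro allI) (simp only:)
qed

lemma quasi_periodic_deriv:
  assumes q: "quasi_periodic \<tau> k \<alpha> \<beta> f" and f: "f holomorphic_on UNIV"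
  shows "deriv f (z + of_int m + of_int n * \<tau>) =
     cexp (of_int m * \<alpha> + of_int n * \<beta> - of_nat k * ((of_int n)\<^sup>2 * \<tau> / 2 + of_int n * z))
       * (deriv f z - 2 * of_real pi * \<i> * of_nat k * of_int n * f z)"
proof -
  define M where "M = (\<lambda>z. cexp (of_int m * \<alpha> + of_int n * \<beta> - of_nat k * ((of_int n)\<^sup>2 * \<tau> / 2 + of_int n * z)))"
  have d: "(f has_field_derivative deriv f x) (at x)" for x
    by (rule holomorphic_derivI[OF f]) auto
  have "((\<lambda>z. f (z + (of_int m + of_int n * \<tau>))) has_field_derivative
          deriv f (z + (of_int m + of_int n * \<tau>))) (at z)"
    using d DERIV_shift by blast
  moreover have "(\<lambda>z. f (z + (of_int m + of_int n * \<tau>))) = (\<lambda>z. M z * f z)"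
    using quasi_periodicD[OF q] by (simp add: M_def add.assoc)
  moreover have "((\<lambda>z. M z * f z) has_field_derivative
      M z * (deriv f z - 2 * of_real pi * \<i> * of_nat k * of_int n * f z)) (at z)"
    unfolding M_def by (auto intro!: derivative_eq_intros d simp: algebra_simps)
  ultimately have "deriv f (z + (of_int m + of_int n * \<tau>))
      = M z * (deriv f z - 2 * of_real pi * \<i> * of_nat k * of_int n * f z)"
    using DERIV_unique by metis
  then show ?thesis by (simp add: M_def add.assoc)
qed

text \<open>
  Under a lattice translation, the derivative acquires an extra multiple of the function itself. The
  multiple depends only on the translation and the order \<open>k\<close>, so it cancels in the Wronskian of two functions of equal order.
\<close>

lemma quasi_periodic_wronskian:
  assumes f: "quasi_periodic \<tau> k \<alpha> \<beta> f" "f holomorphic_on UNIV"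
    and g: "quasi_periodic \<tau> k \<gamma> \<delta> g" "g holomorphic_on UNIV"
  shows "quasi_periodic \<tau> (k + k) (\<alpha> + \<gamma>) (\<beta> + \<delta>) (\<lambda>z. deriv f z * g z - f z * deriv g z)"
  unfolding quasi_periodic_def
proof (intro allI)
  fix m n :: int and z
  have "cexp (of_int m * (\<alpha> + \<gamma>) + of_int n * (\<beta> + \<delta>) - of_nat (k + k) * ((of_int n)\<^sup>2 * \<tau> / 2 + of_int n * z))
      = cexp (of_int m * \<alpha> + of_int n * \<beta> - of_nat k * ((of_int n)\<^sup>2 * \<tau> / 2 + of_int n * z))
      * cexp (of_int m * \<gamma> + of_int n * \<delta> - of_nat k * ((of_int n)\<^sup>2 * \<tau> / 2 + of_int n * z))"
    unfolding cexp_add[symmetric] by (rule arg_cong[of _ _ cexp]) (simp add: algebra_simps)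
  moreover have "A * (f' - c * f0) * (B * g0) - A * f0 * (B * (g' - c * g0)) = A * B * (f' * g0 - f0 * g')"
    for A B c f0 f' g0 g' :: complex by (simp add: algebra_simps)
  ultimately show "deriv f (z + of_int m + of_int n * \<tau>) * g (z + of_int m + of_int n * \<tau>)
      - f (z + of_int m + of_int n * \<tau>) * deriv g (z + of_int m + of_int n * \<tau>) =
     cexp (of_int m * (\<alpha> + \<gamma>) + of_int n * (\<beta> + \<delta>) - of_nat (k + k) * ((of_int n)\<^sup>2 * \<tau> / 2 + of_int n * z))
       * (deriv f z * g z - f z * deriv g z)"
    unfolding quasi_periodicD[OF f(1)] quasi_periodicD[OF g(1)] quasi_periodic_deriv[OF f] quasi_periodic_deriv[OF g]
    by (simp only:)
qed

text \<open>
  A half period \<open>h\<close> is congruent to \<open>- h\<close>, so the value at \<open>h\<close> is the value at \<open>- h\<close> times a factor, while parity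
  prescribes the factor \<open>s\<close>. If the two disagree, the value is \<open>0\<close>.
\<close>

lemma quasi_periodic_half_period_zero:
  assumes q: "quasi_periodic \<tau> k \<alpha> \<beta> f" and parity: "\<And>z. f (- z) = s * f z"
    and ne: "cexp (of_int m * \<alpha> + of_int n * \<beta> + of_nat k * of_int m * of_int n / 2) * s \<noteq> 1"
  shows "f ((of_int m + of_int n * \<tau>) / 2) = 0"
proof -
  define h where "h = (of_int m + of_int n * \<tau>) / 2"
  have "f h = f (- h + of_int m + of_int n * \<tau>)" by (simp add: h_def field_simps)
  also have "\<dots> = cexp (of_int m * \<alpha> + of_int n * \<beta> - of_nat k * ((of_int n)\<^sup>2 * \<tau> / 2 + of_int n * (- h))) * f (- h)"
    by (rule quasi_periodicD[OF q])
  also have "of_int m * \<alpha> + of_int n * \<beta> - of_nat k * ((of_int n)\<^sup>2 * \<tau> / 2 + of_int n * (- h))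
      = of_int m * \<alpha> + of_int n * \<beta> + of_nat k * of_int m * of_int n / 2"
    by (simp add: h_def field_simps power2_eq_square)
  finally have "f h = (cexp (of_int m * \<alpha> + of_int n * \<beta> + of_nat k * of_int m * of_int n / 2) * s) * f h"
    unfolding parity by (simp only: mult_ac)
  then show ?thesis using ne unfolding h_def[symmetric] by (metis mult_cancel_right2)
qed

text \<open>
  All values are taken on the compact period parallelogram, so Liouville's theorem applies.
\<close>

lemma elliptic_entire_constant:
  assumes \<tau>: "Im \<tau> > 0" and h: "h holomorphic_on UNIV"
    and per: "\<And>(m::int) (n::int) z. h (z + of_int m + of_int n * \<tau>) = h z"
  obtains c :: complex where "\<And>z. h z = c"
proof -
  define K where "K = (\<lambda>p. of_real (fst p) + of_real (snd p) * \<tau>) ` ({0..1::real} \<times> {0..1::real})"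
  have "compact K"
    unfolding K_def by (intro compact_continuous_image continuous_intros compact_Times compact_Icc)
  then have "compact (h ` K)"
    using holomorphic_on_imp_continuous_on[OF h] by (metis compact_continuous_image continuous_on_subset subset_UNIV)
  moreover have "range h \<subseteq> h ` K"
  proof
    fix v assume "v \<in> range h"
    then obtain z where v: "v = h z" by blast
    define y where "y = Im z / Im \<tau>"
    define x where "x = Re z - y * Re \<tau>"
    have z: "z = of_real x + of_real y * \<tau>"
      using \<tau> by (simp add: complex_eq_iff x_def y_def)
    define z' where "z' = of_real (x - of_int \<lfloor>x\<rfloor>) + of_real (y - of_int \<lfloor>y\<rfloor>) * \<tau>"
    have "z = z' + of_int \<lfloor>x\<rfloor> + of_int \<lfloor>y\<rfloor> * \<tau>" by (simp add: z z'_def algebra_simps)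
    then have "v = h z'" unfolding v by (metis per)
    moreover have "z' \<in> K"
      unfolding K_def z'_def by (rule image_eqI[of _ _ "(x - of_int \<lfloor>x\<rfloor>, y - of_int \<lfloor>y\<rfloor>)"])
        (auto simp: le_floor_iff of_int_floor_le; linarith)+
    ultimately show "v \<in> h ` K" by blast
  qed
  ultimately have "bounded (range h)" using bounded_subset compact_imp_bounded by blast
  then have "h constant_on UNIV" using Liouville_theorem[OF h] by blast
  then show ?thesis using that by (auto simp: constant_on_def)
qed

text \<open>
  At a simple zero of \<open>g\<close> the quotient of the difference quotients of \<open>f\<close> and \<open>g\<close> tends to the quotient of the
  derivatives, so the value given there makes the quotient continuous, and the singularity is removable.
\<close>

lemma quotient_at_simple_zero_holomorphic:
  assumes f: "f holomorphic_on UNIV" and g: "g holomorphic_on UNIV"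
    and zeros: "\<And>z. g z = 0 \<Longrightarrow> f z = 0 \<and> deriv g z \<noteq> 0"
  shows "(\<lambda>z. if g z = 0 then deriv f z / deriv g z else f z / g z) holomorphic_on UNIV"
proof -
  let ?h = "\<lambda>z. if g z = 0 then deriv f z / deriv g z else f z / g z"
  have df: "(f has_field_derivative deriv f x) (at x)" for x by (rule holomorphic_derivI[OF f]) auto
  have dg: "(g has_field_derivative deriv g x) (at x)" for x by (rule holomorphic_derivI[OF g]) auto
  have contg: "isCont g x" for x using dg DERIV_isCont by blast
  have off: "?h holomorphic_on {z. g z \<noteq> 0}"
  proof -
    have "(\<lambda>z. f z / g z) holomorphic_on {z. g z \<noteq> 0}"
      by (intro holomorphic_on_divide holomorphic_on_subset[OF f] holomorphic_on_subset[OF g]) auto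
    then show ?thesis by (rule holomorphic_transform) auto
  qed
  have "?h field_differentiable at a" for a
  proof -
    have "\<forall>\<^sub>F z in at a. g z \<noteq> 0"
    proof (cases "g a = 0")
      case True
      have "((\<lambda>z. (g z - g a) / (z - a)) \<longlongrightarrow> deriv g a) (at a)"
        using dg[of a] by (simp add: has_field_derivative_iff)
      then have "\<forall>\<^sub>F z in at a. (g z - g a) / (z - a) \<noteq> 0"
        using zeros[OF True] by (intro tendsto_imp_eventually_ne) auto
      then show ?thesis by eventually_elim (auto simp: True)
    next
      case False
      then show ?thesis using contg[of a] unfolding isCont_def by (intro tendsto_imp_eventually_ne)
    qed
    then obtain r where r: "r > 0" "\<And>z. z \<noteq> a \<Longrightarrow> dist z a < r \<Longrightarrow> g z \<noteq> 0"
      unfolding eventually_at by auto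
    have "?h holomorphic_on ball a r"
    proof (rule no_isolated_singularity'[of "{a}"])
      show "?h holomorphic_on ball a r - {a}"
        by (rule holomorphic_on_subset[OF off]) (use r in \<open>auto simp: dist_commute\<close>)
      fix z assume "z \<in> {a}"
      then have za: "z = a" by simp
      have "(?h \<longlongrightarrow> ?h a) (at a)"
      proof (cases "g a = 0")
        case True
        have "((\<lambda>z. ((f z - f a) / (z - a)) / ((g z - g a) / (z - a))) \<longlongrightarrow> deriv f a / deriv g a) (at a)"
          using df[of a] dg[of a] zeros[OF True] by (intro tendsto_divide) (auto simp: has_field_derivative_iff)
        moreover have "\<forall>\<^sub>F z in at a. ((f z - f a) / (z - a)) / ((g z - g a) / (z - a)) = ?h z"
          unfolding eventually_at using r zeros[OF True] True by (intro exI[of _ r]) auto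
        ultimately show ?thesis using True Lim_transform_eventually by fastforce
      next
        case False
        moreover have "open {z. g z \<noteq> 0}"
          using contg by (intro open_Collect_neq continuous_at_imp_continuous_on) auto
        ultimately have "?h field_differentiable at a"
          by (intro holomorphic_on_imp_differentiable_at[OF off]) auto
        then show ?thesis using field_differentiable_imp_continuous_at isCont_def by blast
      qed
      then show "(?h \<longlongrightarrow> ?h z) (at z within ball a r)"
        unfolding za using tendsto_within_subset by blast
    qed auto
    then show ?thesis using r(1) by (intro holomorphic_on_imp_differentiable_at[of _ "ball a r"]) auto
  qed
  then show ?thesis by (auto simp: holomorphic_on_def)
qed

text \<open>
  The quotient is entire because the zeros of \<open>g\<close> are simple and cancel, and doubly periodic because the factors
  cancel. At a zero of \<open>g\<close> the quotient is that of the derivatives, which have the common factor as well once the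
  functions themselves vanish.
\<close>

lemma quasi_periodic_proportional:
  assumes \<tau>: "Im \<tau> > 0"
    and f: "f holomorphic_on UNIV" "quasi_periodic \<tau> k \<alpha> \<beta> f"
    and g: "g holomorphic_on UNIV" "quasi_periodic \<tau> k \<alpha> \<beta> g"
    and zeros: "\<And>z. g z = 0 \<Longrightarrow> f z = 0 \<and> deriv g z \<noteq> 0"
  obtains c where "\<And>z. f z = c * g z"
proof -
  define h where "h = (\<lambda>z. if g z = 0 then deriv f z / deriv g z else f z / g z)"
  have "h holomorphic_on UNIV"
    unfolding h_def using f(1) g(1) zeros by (rule quotient_at_simple_zero_holomorphic)
  moreover have "h (z + of_int m + of_int n * \<tau>) = h z" for m n :: int and z
    using zeros[of z] unfolding h_def
    by (simp add: quasi_periodicD[OF f(2)] quasi_periodicD[OF g(2)]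
        quasi_periodic_deriv[OF f(2,1)] quasi_periodic_deriv[OF g(2,1)])
  ultimately obtain c where c: "\<And>z. h z = c" using elliptic_entire_constant[OF \<tau>] by metis
  have "f z = c * g z" for z
    using c[of z] zeros[of z] by (cases "g z = 0") (auto simp: h_def)
  then show ?thesis by (rule that)
qed

section \<open>Simplicity and separation of the zeros\<close>

definition simple_zeros :: "(complex \<Rightarrow> complex) \<Rightarrow> bool" where
  "simple_zeros g \<longleftrightarrow> (\<forall>z. g z = 0 \<longrightarrow> deriv g z \<noteq> 0)"

lemma simple_zeros_mult:
  assumes f: "f holomorphic_on UNIV" "simple_zeros f" and g: "g holomorphic_on UNIV" "simple_zeros g"
    and disj: "\<And>z. f z \<noteq> 0 \<or> g z \<noteq> 0"
  shows "simple_zeros (\<lambda>z. f z * g z)"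
  unfolding simple_zeros_def
proof (intro allI impI)
  fix z assume z: "f z * g z = 0"
  have "f field_differentiable at z" "g field_differentiable at z"
    using f(1) g(1) by (simp_all add: holomorphic_on_def)
  then have "deriv (\<lambda>z. f z * g z) z = f z * deriv g z + deriv f z * g z" by (rule deriv_mult)
  then show "deriv (\<lambda>z. f z * g z) z \<noteq> 0"
    using z disj[of z] f(2) g(2) by (auto simp: simple_zeros_def)
qed

lemma theta_char_zero_imp:
  assumes \<tau>: "Im \<tau> > 0" and zero: "theta_char \<epsilon> \<epsilon>' z \<tau> = 0"
  shows "\<exists>m n::int. z = (of_real (1 - \<epsilon>') + of_real (1 - \<epsilon>) * \<tau>) / 2 + of_int m + of_int n * \<tau>"
proof -
  have "theta_char 0 0 (z + of_real \<epsilon>' / 2 + of_real \<epsilon> * \<tau> / 2) \<tau> = 0"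
    using zero unfolding theta_char_eq_theta_00[of \<epsilon> \<epsilon>'] by simp
  from theta_00_zero_imp[OF \<tau> this] obtain m n :: int
    where "z + of_real \<epsilon>' / 2 + of_real \<epsilon> * \<tau> / 2 = (1 + \<tau>) / 2 + of_int m + of_int n * \<tau>" by blast
  then have "z = (1 + \<tau>) / 2 + of_int m + of_int n * \<tau> - of_real \<epsilon> * \<tau> / 2 - of_real \<epsilon>' / 2"
    by (metis add_diff_cancel_right')
  also have "\<dots> = (of_real (1 - \<epsilon>') + of_real (1 - \<epsilon>) * \<tau>) / 2 + of_int m + of_int n * \<tau>"
    by (simp add: field_simps)
  finally show ?thesis by blast
qed

text \<open>
  Up to a lattice translation and a factor without zeros, \<open>\<theta>\<close> has a single zero, that of \<open>\<theta>\<^sub>0\<^sub>0\<close> at \<open>(1 + \<tau>) / 2\<close>,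
  and there the derivative is the non-zero number found from the triple product.
\<close>

lemma simple_zeros_theta_char:
  assumes \<tau>: "Im \<tau> > 0"
  shows "simple_zeros (\<lambda>z. theta_char \<epsilon> \<epsilon>' z \<tau>)"
  unfolding simple_zeros_def
proof (intro allI impI)
  fix z assume zero: "theta_char \<epsilon> \<epsilon>' z \<tau> = 0"
  define T a E where "T = (\<lambda>z. theta_char 0 0 z \<tau>)" and "a = of_real \<epsilon>' / 2 + of_real \<epsilon> * \<tau> / 2"
    and "E = (\<lambda>z. cexp ((of_real \<epsilon>)\<^sup>2 * \<tau> / 8 + of_real \<epsilon> / 2 * (z + of_real \<epsilon>' / 2)))"
  have T: "T holomorphic_on UNIV" unfolding T_def by (rule theta_char_holomorphic[OF \<tau>])
  have eq: "theta_char \<epsilon> \<epsilon>' z \<tau> = E z * T (z + a)" for z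
    unfolding theta_char_eq_theta_00[of \<epsilon> \<epsilon>'] by (simp add: E_def T_def a_def add.assoc)
  have Ta: "T (z + a) = 0" using zero unfolding eq by (simp add: E_def)
  then obtain m n :: int where mn: "z + a = (1 + \<tau>) / 2 + of_int m + of_int n * \<tau>"
    using theta_00_zero_imp[OF \<tau>] unfolding T_def by blast
  have qp: "quasi_periodic \<tau> 1 0 0 T"
    using quasi_periodic_theta[of \<tau> 0 0] by (simp add: T_def)
  have T0: "T ((1 + \<tau>) / 2) = 0"
    using Ta quasi_periodicD[OF qp, of "(1 + \<tau>) / 2" m n] unfolding mn by simp
  have "deriv T (z + a) \<noteq> 0"
    unfolding mn quasi_periodic_deriv[OF qp T] T0
    using deriv_theta_00_zero[OF \<tau>] qpoch_inf_nonzero[OF norm_nome_sq_less_1[OF \<tau>]] by (simp add: T_def)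
  moreover have "((\<lambda>z. E z * T (z + a)) has_field_derivative E z * deriv T (z + a) + deriv E z * T (z + a)) (at z)"
  proof (rule DERIV_mult')
    show "(E has_field_derivative deriv E z) (at z)"
      unfolding E_def by (rule holomorphic_derivI[of _ UNIV]) (auto intro!: holomorphic_intros)
    show "((\<lambda>z. T (z + a)) has_field_derivative deriv T (z + a)) (at z)"
      using holomorphic_derivI[OF T, of "z + a"] DERIV_shift by blast
  qed
  ultimately show "deriv (\<lambda>z. theta_char \<epsilon> \<epsilon>' z \<tau>) z \<noteq> 0"
    unfolding eq using Ta DERIV_imp_deriv by (simp add: E_def DERIV_imp_deriv)
qed

text \<open>
  By \<open>theta_char_zero_imp\<close> the characteristic determines the zeros modulo the lattice, and \<open>1\<close>, \<open>\<tau>\<close> are linearly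
  independent over the reals. So theta functions share a zero only if their characteristics agree modulo \<open>2\<close>.
\<close>

lemma theta_char_common_zero_imp:
  assumes \<tau>: "Im \<tau> > 0" and "theta_char \<epsilon> \<epsilon>' z \<tau> = 0" "theta_char \<delta> \<delta>' z \<tau> = 0"
  shows "(\<epsilon> - \<delta>) / 2 \<in> \<int>" "(\<epsilon>' - \<delta>') / 2 \<in> \<int>"
proof -
  obtain m n m' n' :: int where
    1: "z = (of_real (1 - \<epsilon>') + of_real (1 - \<epsilon>) * \<tau>) / 2 + of_int m + of_int n * \<tau>" and
    2: "z = (of_real (1 - \<delta>') + of_real (1 - \<delta>) * \<tau>) / 2 + of_int m' + of_int n' * \<tau>"
    using theta_char_zero_imp[OF \<tau>] assms(2,3) by metis
  define x y where "x = (\<epsilon> - \<delta>) / 2 - of_int (n - n')" and "y = (\<epsilon>' - \<delta>') / 2 - of_int (m - m')"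
  have "of_real y + of_real x * \<tau> = 0"
    using 1 2 by (simp add: x_def y_def field_simps)
  then have "Im (of_real y + of_real x * \<tau>) = 0" "Re (of_real y + of_real x * \<tau>) = 0" by simp_all
  then have "x = 0" "y = 0" using \<tau> by auto
  then have "(\<epsilon> - \<delta>) / 2 = of_int (n - n')" "(\<epsilon>' - \<delta>') / 2 = of_int (m - m')"
    by (simp_all add: x_def y_def)
  then show "(\<epsilon> - \<delta>) / 2 \<in> \<int>" "(\<epsilon>' - \<delta>') / 2 \<in> \<int>" by (simp_all only: Ints_of_int)
qed

lemma not_Ints_between_0_1: "0 < x \<Longrightarrow> x < 1 \<Longrightarrow> (x::real) \<notin> \<int>"
  by (auto elim!: Ints_cases)

lemma theta_char_add_one: "theta_char \<epsilon> \<epsilon>' (z + 1) \<tau> = cexp (of_real \<epsilon> / 2) * theta_char \<epsilon> \<epsilon>' z \<tau>"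
  using theta_char_lattice[of \<epsilon> \<epsilon>' z 1 0 \<tau>] by simp

lemma theta_11_add_one: "theta_char 1 1 (z + 1) \<tau> = - theta_char 1 1 z \<tau>"
  by (simp add: theta_char_add_one)

lemma theta_11_odd: "theta_char 1 1 (- z) \<tau> = - theta_char 1 1 z \<tau>"
proof -
  have "theta_char 1 1 (- z) \<tau> = theta_char 1 (- 1) z \<tau>"
    using theta_char_minus[of 1 1 z \<tau>] theta_char_add_2[of "- 1" "- 1" z \<tau>] by simp
  also have "\<dots> = theta_char 1 1 (z - 1) \<tau>" using theta_char_shift[of 1 1 z "- 2" \<tau>] by simp
  also have "\<dots> = - theta_char 1 1 z \<tau>" using theta_11_add_one[of "z - 1" \<tau>] by simp
  finally show ?thesis .
qed

text \<open>
  \<open>\<theta>\<^sub>1\<^sub>1\<close> vanishes at \<open>0\<close>, and only functions with a characteristic congruent to \<open>[1, 1]\<close> can share this zero.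
\<close>

lemma theta_const_nonzero:
  assumes \<tau>: "Im \<tau> > 0" and "(1 - \<epsilon>) / 2 \<notin> \<int> \<or> (1 - \<epsilon>') / 2 \<notin> \<int>"
  shows "theta_char \<epsilon> \<epsilon>' 0 \<tau> \<noteq> 0"
proof -
  have "theta_char 1 1 0 \<tau> = 0" using theta_11_odd[of 0 \<tau>] by simp
  then show ?thesis
    using theta_char_common_zero_imp[OF \<tau>, of 1 1 0 \<epsilon> \<epsilon>'] assms(2) by blast
qed

section \<open>Two identities between theta functions\<close>

context
  fixes \<tau> :: complex
  assumes \<tau>: "Im \<tau> > 0"
begin

abbreviation "\<theta>\<^sub>1\<^sub>1 z \<equiv> theta_char 1 1 z \<tau>"
abbreviation "\<theta>\<^sub>1\<^sub>0 z \<equiv> theta_char 1 0 z \<tau>"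
abbreviation "\<theta>\<^sub>0\<^sub>0 z \<equiv> theta_char 0 0 z \<tau>"
abbreviation "\<theta>\<^sub>0\<^sub>1 z \<equiv> theta_char 0 1 z \<tau>"

lemma theta_10_eq: "\<theta>\<^sub>1\<^sub>0 z = \<theta>\<^sub>1\<^sub>1 (z - 1 / 2)"
  using theta_char_shift[of 1 1 z "- 1" \<tau>] by simp

lemma theta_10_even: "\<theta>\<^sub>1\<^sub>0 (- z) = \<theta>\<^sub>1\<^sub>0 z"
proof -
  have "\<theta>\<^sub>1\<^sub>0 (- z) = - \<theta>\<^sub>1\<^sub>1 (z + 1 / 2)"
    using theta_11_odd[of "z + 1 / 2" \<tau>] by (simp add: theta_10_eq)
  also have "\<dots> = \<theta>\<^sub>1\<^sub>1 (z - 1 / 2)"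
    using theta_11_add_one[of "z - 1 / 2" \<tau>] by (simp add: add.commute)
  finally show ?thesis by (simp add: theta_10_eq)
qed

lemma theta_00_even: "\<theta>\<^sub>0\<^sub>0 (- z) = \<theta>\<^sub>0\<^sub>0 z"
  using theta_char_minus[of 0 0 z \<tau>] by simp

lemma theta_00_add_half: "\<theta>\<^sub>0\<^sub>0 (z + 1 / 2) = \<theta>\<^sub>0\<^sub>1 z"
  using theta_char_shift[of 0 0 z 1 \<tau>] by simp

lemma theta_01_add_half: "\<theta>\<^sub>0\<^sub>1 (z + 1 / 2) = \<theta>\<^sub>0\<^sub>0 z"
  using theta_00_add_half[of "z + 1 / 2"] theta_char_add_one[of 0 0 z \<tau>] by (simp add: add.commute)

lemma deriv_theta_11_even: "deriv (\<lambda>z. \<theta>\<^sub>1\<^sub>1 z) (- z) = deriv (\<lambda>z. \<theta>\<^sub>1\<^sub>1 z) z"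
proof -
  have d: "((\<lambda>z. \<theta>\<^sub>1\<^sub>1 z) has_field_derivative deriv (\<lambda>z. \<theta>\<^sub>1\<^sub>1 z) x) (at x)" for x
    by (rule holomorphic_derivI[OF theta_char_holomorphic[OF \<tau>, of _ _ UNIV]]) auto
  have "((\<lambda>z. \<theta>\<^sub>1\<^sub>1 (- z)) has_field_derivative deriv (\<lambda>z. \<theta>\<^sub>1\<^sub>1 z) (- z) * (- 1)) (at z)"
    by (rule DERIV_chain2[OF d]) (auto intro!: derivative_eq_intros)
  moreover have "((\<lambda>z. - \<theta>\<^sub>1\<^sub>1 z) has_field_derivative - deriv (\<lambda>z. \<theta>\<^sub>1\<^sub>1 z) z) (at z)"
    using d by (rule DERIV_minus)
  ultimately show ?thesis
    unfolding theta_11_odd using DERIV_unique by fastforce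
qed

lemma deriv_theta_char_shift:
  "deriv (\<lambda>z. theta_char \<epsilon> (\<epsilon>' + t) z \<tau>) z = deriv (\<lambda>z. theta_char \<epsilon> \<epsilon>' z \<tau>) (z + of_real t / 2)"
proof -
  have "((\<lambda>z. theta_char \<epsilon> \<epsilon>' z \<tau>) has_field_derivative
      deriv (\<lambda>z. theta_char \<epsilon> \<epsilon>' z \<tau>) (z + of_real t / 2)) (at (z + of_real t / 2))"
    by (rule holomorphic_derivI[OF theta_char_holomorphic[OF \<tau>, of _ _ UNIV]]) auto
  then have "((\<lambda>z. theta_char \<epsilon> \<epsilon>' (z + of_real t / 2) \<tau>) has_field_derivative
      deriv (\<lambda>z. theta_char \<epsilon> \<epsilon>' z \<tau>) (z + of_real t / 2)) (at z)"
    by (simp only: DERIV_shift)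
  then show ?thesis unfolding theta_char_shift by (rule DERIV_imp_deriv)
qed

lemma theta_00_01_zero_imp:
  assumes "\<theta>\<^sub>0\<^sub>0 z * \<theta>\<^sub>0\<^sub>1 z = 0"
  obtains e m n :: int where "e \<in> {0, 1}" "z = (of_int e + of_int 1 * \<tau>) / 2 + of_int m + of_int n * \<tau>"
proof (cases "\<theta>\<^sub>0\<^sub>0 z = 0")
  case True
  then show ?thesis using theta_char_zero_imp[OF \<tau> True] that[of 1] by auto
next
  case False
  then have "\<theta>\<^sub>0\<^sub>1 z = 0" using assms by simp
  from theta_char_zero_imp[OF \<tau> this] show ?thesis using that[of 0] by auto
qed

lemma not_Ints_half: "(1 / 2 :: real) \<notin> \<int>" "(- 1 / 2 :: real) \<notin> \<int>"
  using not_Ints_between_0_1[of "1 / 2"] by (simp_all add: minus_in_Ints_iff)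

lemma simple_zeros_theta_00_01: "simple_zeros (\<lambda>z. \<theta>\<^sub>0\<^sub>0 z * \<theta>\<^sub>0\<^sub>1 z)"
proof (intro simple_zeros_mult theta_char_holomorphic simple_zeros_theta_char \<tau>)
  show "\<theta>\<^sub>0\<^sub>0 z \<noteq> 0 \<or> \<theta>\<^sub>0\<^sub>1 z \<noteq> 0" for z
    using theta_char_common_zero_imp(2)[OF \<tau>, of 0 0 z 0 1] not_Ints_half by auto
qed

lemma simple_zeros_theta_11_00_01: "simple_zeros (\<lambda>z. \<theta>\<^sub>1\<^sub>1 z * (\<theta>\<^sub>0\<^sub>0 z * \<theta>\<^sub>0\<^sub>1 z))"
proof (rule simple_zeros_mult)
  show "\<theta>\<^sub>1\<^sub>1 z \<noteq> 0 \<or> \<theta>\<^sub>0\<^sub>0 z * \<theta>\<^sub>0\<^sub>1 z \<noteq> 0" for z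
    using theta_char_common_zero_imp(1)[OF \<tau>, of 1 1 z 0] not_Ints_half by auto
qed (intro holomorphic_intros theta_char_holomorphic simple_zeros_theta_char simple_zeros_theta_00_01 \<tau>)+

text \<open>
  The Wronskian is even, whereas \<open>\<theta>\<^sub>1\<^sub>1 \<theta>\<^sub>1\<^sub>0\<close>, which has the same factors, is odd and does not vanish at \<open>\<tau> / 2\<close>
  and \<open>(1 + \<tau>) / 2\<close>. This forces the Wronskian to vanish at these two half periods, the zeros of \<open>\<theta>\<^sub>0\<^sub>0 \<theta>\<^sub>0\<^sub>1\<close>.
\<close>

lemma wronskian_11_10:
  shows "\<exists>c. \<forall>z. deriv (\<lambda>z. \<theta>\<^sub>1\<^sub>1 z) z * \<theta>\<^sub>1\<^sub>0 z - \<theta>\<^sub>1\<^sub>1 z * deriv (\<lambda>z. \<theta>\<^sub>1\<^sub>0 z) z = c * (\<theta>\<^sub>0\<^sub>0 z * \<theta>\<^sub>0\<^sub>1 z)"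
proof -
  define W where "W = (\<lambda>z. deriv (\<lambda>z. \<theta>\<^sub>1\<^sub>1 z) z * \<theta>\<^sub>1\<^sub>0 z - \<theta>\<^sub>1\<^sub>1 z * deriv (\<lambda>z. \<theta>\<^sub>1\<^sub>0 z) z)"
  have W_hol: "W holomorphic_on UNIV"
    unfolding W_def by (intro holomorphic_intros theta_char_holomorphic \<tau>) auto
  have "quasi_periodic \<tau> (1 + 1) (of_real 1 / 2 + of_real 1 / 2) (- of_real 1 / 2 + - of_real 0 / 2) W"
    unfolding W_def by (intro quasi_periodic_wronskian quasi_periodic_theta theta_char_holomorphic \<tau>)
  then have "quasi_periodic \<tau> 2 1 (- 1 / 2) W" by (simp add: numeral_2_eq_2)
  then have W_qp: "quasi_periodic \<tau> 2 0 (- 1 / 2) W"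
    by (rule quasi_periodic_characteristic_cong[where a = "- 1" and b = 0]) simp_all
  have "quasi_periodic \<tau> (1 + 1) (of_real 0 / 2 + of_real 0 / 2) (- of_real 0 / 2 + - of_real 1 / 2)
      (\<lambda>z. \<theta>\<^sub>0\<^sub>0 z * \<theta>\<^sub>0\<^sub>1 z)"
    by (intro quasi_periodic_mult quasi_periodic_theta)
  then have g_qp: "quasi_periodic \<tau> 2 0 (- 1 / 2) (\<lambda>z. \<theta>\<^sub>0\<^sub>0 z * \<theta>\<^sub>0\<^sub>1 z)" by (simp add: numeral_2_eq_2)
  have d10: "deriv (\<lambda>z. \<theta>\<^sub>1\<^sub>0 z) z = deriv (\<lambda>z. \<theta>\<^sub>1\<^sub>1 z) (z - 1 / 2)" for z
    using deriv_theta_char_shift[of 1 1 "- 1" z] by simp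
  have d11: "deriv (\<lambda>z. \<theta>\<^sub>1\<^sub>1 z) (z + 1) = - deriv (\<lambda>z. \<theta>\<^sub>1\<^sub>1 z) z" for z
    using quasi_periodic_deriv[OF quasi_periodic_theta theta_char_holomorphic[OF \<tau>], of 1 1 z 1 0] by simp
  have d10_odd: "deriv (\<lambda>z. \<theta>\<^sub>1\<^sub>0 z) (- z) = - deriv (\<lambda>z. \<theta>\<^sub>1\<^sub>0 z) z" for z
    using deriv_theta_11_even[of "z + 1 / 2"] d11[of "z - 1 / 2"] by (simp add: d10 add.commute)
  have W_even: "W (- z) = 1 * W z" for z
    unfolding W_def by (simp add: theta_11_odd theta_10_even deriv_theta_11_even d10_odd)
  have zero: "W z = 0" if z: "\<theta>\<^sub>0\<^sub>0 z * \<theta>\<^sub>0\<^sub>1 z = 0" for z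
  proof -
    obtain e m n :: int where e: "e \<in> {0, 1}"
      and z_eq: "z = (of_int e + of_int 1 * \<tau>) / 2 + of_int m + of_int n * \<tau>"
      by (rule theta_00_01_zero_imp[OF z])
    have "W ((of_int e + of_int 1 * \<tau>) / 2) = 0"
      by (rule quasi_periodic_half_period_zero[OF W_qp W_even])
         (use e in \<open>auto simp: exp_minus cexp_add\<close>)
    then show ?thesis unfolding z_eq quasi_periodicD[OF W_qp] by simp
  qed
  obtain c where "\<And>z. W z = c * (\<theta>\<^sub>0\<^sub>0 z * \<theta>\<^sub>0\<^sub>1 z)"
    using simple_zeros_theta_00_01 zero
    by (rule_tac quasi_periodic_proportional[OF \<tau> W_hol W_qp _ g_qp])
       (auto simp: simple_zeros_def intro!: holomorphic_intros theta_char_holomorphic \<tau>)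
  then show ?thesis unfolding W_def by blast
qed

text \<open>
  The shift \<open>1 / 6\<close> is chosen such that the cubes of the two translates have the same factors: under \<open>\<tau>\<close> these
  differ by \<open>cexp (3 * (1 / 3)) = 1\<close>. Their sum is then quasi-periodic, and it is odd, so it vanishes at \<open>0\<close>. At
  \<open>\<tau> / 2\<close> and \<open>(1 + \<tau>) / 2\<close> the factors are those of an even function, which forces zeros there too.
\<close>

lemma sum_of_cubes_11:
  shows "\<exists>c. \<forall>z. \<theta>\<^sub>1\<^sub>1 (z - 1 / 6) ^ 3 + \<theta>\<^sub>1\<^sub>1 (z + 1 / 6) ^ 3 = c * (\<theta>\<^sub>1\<^sub>1 z * (\<theta>\<^sub>0\<^sub>0 z * \<theta>\<^sub>0\<^sub>1 z))"
proof -
  define F where "F = (\<lambda>z. \<theta>\<^sub>1\<^sub>1 (z - 1 / 6) ^ 3 + \<theta>\<^sub>1\<^sub>1 (z + 1 / 6) ^ 3)"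
  have F_eq: "F = (\<lambda>z. theta_char 1 (2 / 3) z \<tau> ^ 3 + theta_char 1 (4 / 3) z \<tau> ^ 3)"
  proof
    fix z show "F z = theta_char 1 (2 / 3) z \<tau> ^ 3 + theta_char 1 (4 / 3) z \<tau> ^ 3"
      using theta_char_shift[of 1 1 z "- 1 / 3" \<tau>] theta_char_shift[of 1 1 z "1 / 3" \<tau>]
      by (simp add: F_def)
  qed
  have F_hol: "F holomorphic_on UNIV"
    unfolding F_eq by (intro holomorphic_intros theta_char_holomorphic \<tau>)
  have "quasi_periodic \<tau> 3 (1 / 2) 0 (\<lambda>z. theta_char 1 (2 / 3) z \<tau> ^ 3)"
  proof (rule quasi_periodic_characteristic_cong[where a = "- 1" and b = 1])
    show "quasi_periodic \<tau> 3 (3 / 2) (- 1) (\<lambda>z. theta_char 1 (2 / 3) z \<tau> ^ 3)"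
      using quasi_periodic_power3[OF quasi_periodic_theta[of \<tau> 1 "2 / 3"]] by simp
  qed simp_all
  moreover have "quasi_periodic \<tau> 3 (1 / 2) 0 (\<lambda>z. theta_char 1 (4 / 3) z \<tau> ^ 3)"
  proof (rule quasi_periodic_characteristic_cong[where a = "- 1" and b = 2])
    show "quasi_periodic \<tau> 3 (3 / 2) (- 2) (\<lambda>z. theta_char 1 (4 / 3) z \<tau> ^ 3)"
      using quasi_periodic_power3[OF quasi_periodic_theta[of \<tau> 1 "4 / 3"]] by simp
  qed simp_all
  ultimately have F_qp: "quasi_periodic \<tau> 3 (1 / 2) 0 F"
    unfolding F_eq by (rule quasi_periodic_add)
  have "quasi_periodic \<tau> (1 + (1 + 1)) (of_real 1 / 2 + (of_real 0 / 2 + of_real 0 / 2))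
      (- of_real 1 / 2 + (- of_real 0 / 2 + - of_real 1 / 2)) (\<lambda>z. \<theta>\<^sub>1\<^sub>1 z * (\<theta>\<^sub>0\<^sub>0 z * \<theta>\<^sub>0\<^sub>1 z))"
    by (intro quasi_periodic_mult quasi_periodic_theta)
  then have "quasi_periodic \<tau> (1 + (1 + 1)) (1 / 2) 0 (\<lambda>z. \<theta>\<^sub>1\<^sub>1 z * (\<theta>\<^sub>0\<^sub>0 z * \<theta>\<^sub>0\<^sub>1 z))"
    by (rule quasi_periodic_characteristic_cong[where a = 0 and b = 1]) simp_all
  then have g_qp: "quasi_periodic \<tau> 3 (1 / 2) 0 (\<lambda>z. \<theta>\<^sub>1\<^sub>1 z * (\<theta>\<^sub>0\<^sub>0 z * \<theta>\<^sub>0\<^sub>1 z))"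
    by (simp add: numeral_3_eq_3)
  have F_odd: "F (- z) = (- 1) * F z" for z
    using theta_11_odd[of "z + 1 / 6" \<tau>] theta_11_odd[of "z - 1 / 6" \<tau>] by (simp add: F_def)
  have zero: "F z = 0" if z: "\<theta>\<^sub>1\<^sub>1 z * (\<theta>\<^sub>0\<^sub>0 z * \<theta>\<^sub>0\<^sub>1 z) = 0" for z
  proof (cases "\<theta>\<^sub>1\<^sub>1 z = 0")
    case True
    then obtain m n :: int where z_eq: "z = 0 + of_int m + of_int n * \<tau>"
      using theta_char_zero_imp[OF \<tau> True] by auto
    have "F 0 = 0" using F_odd[of 0] by simp
    then show ?thesis unfolding z_eq quasi_periodicD[OF F_qp] by simp
  next
    case False
    then have "\<theta>\<^sub>0\<^sub>0 z * \<theta>\<^sub>0\<^sub>1 z = 0" using z by simp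
    then obtain e m n :: int where e: "e \<in> {0, 1}"
      and z_eq: "z = (of_int e + of_int 1 * \<tau>) / 2 + of_int m + of_int n * \<tau>"
      by (rule theta_00_01_zero_imp)
    have "F ((of_int e + of_int 1 * \<tau>) / 2) = 0"
    proof (rule quasi_periodic_half_period_zero[OF F_qp F_odd])
      have "cexp (of_int e * (1 / 2) + of_int 1 * 0 + of_nat 3 * of_int e * of_int 1 / 2) = cexp (of_int (2 * e))"
        by (intro arg_cong[of _ _ cexp]) simp
      then show "cexp (of_int e * (1 / 2) + of_int 1 * 0 + of_nat 3 * of_int e * of_int 1 / 2) * - 1 \<noteq> 1"
        unfolding cexp_int by (simp only:) simp
    qed
    then show ?thesis unfolding z_eq quasi_periodicD[OF F_qp] by simp
  qed
  obtain c where "\<And>z. F z = c * (\<theta>\<^sub>1\<^sub>1 z * (\<theta>\<^sub>0\<^sub>0 z * \<theta>\<^sub>0\<^sub>1 z))"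
    using simple_zeros_theta_11_00_01 zero
    by (rule_tac quasi_periodic_proportional[OF \<tau> F_hol F_qp _ g_qp])
       (auto simp: simple_zeros_def intro!: holomorphic_intros theta_char_holomorphic \<tau>)
  then show ?thesis unfolding F_def by blast
qed

end

section \<open>The logarithmic derivative at the division point\<close>

theorem theorem6p7:
  fixes \<tau> :: complex
  assumes "Im \<tau> > 0"
  shows "theta_deriv_const 1 (1/3) \<tau> / theta_const 1 (1/3) \<tau>
       = - (1/3) * ((theta_deriv_const 1 1 \<tau> * theta_const 1 (1/3) \<tau> ^ 3)
                    / (theta_const 1 0 \<tau> * theta_const 1 (2/3) \<tau> ^ 3))
         + (theta_deriv_const 1 1 \<tau> * theta_const 1 0 \<tau>
              * theta_const 0 (1/3) \<tau> * theta_const 0 (2/3) \<tau>)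
           / (theta_const 0 0 \<tau> * theta_const 0 1 \<tau>
              * theta_const 1 (1/3) \<tau> * theta_const 1 (2/3) \<tau>)
     \<and> - (1/3) * ((theta_deriv_const 1 1 \<tau> * theta_const 1 (1/3) \<tau> ^ 3)
                    / (theta_const 1 0 \<tau> * theta_const 1 (2/3) \<tau> ^ 3))
         + (theta_deriv_const 1 1 \<tau> * theta_const 1 0 \<tau>
              * theta_const 0 (1/3) \<tau> * theta_const 0 (2/3) \<tau>)
           / (theta_const 0 0 \<tau> * theta_const 0 1 \<tau>
              * theta_const 1 (1/3) \<tau> * theta_const 1 (2/3) \<tau>)
       = of_real pi / 3 * theta_const 0 0 \<tau> * theta_const 0 1 \<tau>
           * (theta_const 1 (1/3) \<tau> ^ 3 / theta_const 1 (2/3) \<tau> ^ 3)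
         - of_real pi * theta_const 1 0 \<tau> ^ 2
           * ((theta_const 0 (1/3) \<tau> * theta_const 0 (2/3) \<tau>)
              / (theta_const 1 (1/3) \<tau> * theta_const 1 (2/3) \<tau>))"
proof -
  note \<tau> = assms
  define t t' where "t = (\<lambda>z. theta_char 1 1 z \<tau>)" and "t' = deriv t"
  define a b where "a = theta_const 1 (1/3) \<tau>" and "b = theta_const 1 (2/3) \<tau>"
  define u v where "u = theta_const 0 (1/3) \<tau>" and "v = theta_const 0 (2/3) \<tau>"
  define s0 u0 v0 where "s0 = theta_const 1 0 \<tau>" and "u0 = theta_const 0 0 \<tau>" and "v0 = theta_const 0 1 \<tau>"
  have dt: "(t has_field_derivative t' z) (at z)" for z
    unfolding t_def t'_def by (rule holomorphic_derivI[OF theta_char_holomorphic[OF \<tau>, of _ _ UNIV]]) auto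
  have t_odd: "t (- z) = - t z" and t_add_one: "t (z + 1) = - t z" for z
    by (simp_all add: t_def theta_11_odd theta_11_add_one)
  have t'_even: "t' (- z) = t' z" for z
    unfolding t'_def t_def by (rule deriv_theta_11_even[OF \<tau>])
  have t'_add_one: "t' (z + 1) = - t' z" for z
    using quasi_periodic_deriv[OF quasi_periodic_theta theta_char_holomorphic[OF \<tau>], of 1 1 z 1 0]
    by (simp add: t'_def t_def)
  have nz: "a \<noteq> 0" "b \<noteq> 0" "s0 \<noteq> 0" "u0 \<noteq> 0" "v0 \<noteq> 0"
    unfolding a_def b_def s0_def u0_def v0_def theta_const_def
    by (rule theta_const_nonzero[OF \<tau>]; use not_Ints_between_0_1 in force)+
  have t13: "t (1 / 3) = - a" and t23: "t (2 / 3) = - a" and t16: "t (1 / 6) = - b" and t56: "t (- 5 / 6) = b"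
    and t12: "t (1 / 2) = - s0"
  proof -
    show "t (1 / 3) = - a"
      using theta_char_shift[of 1 1 0 "- 2 / 3" \<tau>] t_odd[of "- 1 / 3"] by (simp add: t_def a_def theta_const_def)
    then show "t (2 / 3) = - a" using t_add_one[of "- 1 / 3"] t_odd[of "1 / 3"] by simp
    show *: "t (1 / 6) = - b"
      using theta_char_shift[of 1 1 0 "- 1 / 3" \<tau>] t_odd[of "- 1 / 6"] by (simp add: t_def b_def theta_const_def)
    show "t (- 5 / 6) = b" using t_add_one[of "- 5 / 6"] * by simp
    show "t (1 / 2) = - s0"
      using theta_10_eq[OF \<tau>, of 0] t_odd[of "1 / 2"] by (simp add: t_def s0_def theta_const_def)
  qed
  have t'13: "theta_deriv_const 1 (1/3) \<tau> = t' (- 1 / 3)"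
    using deriv_theta_char_shift[OF \<tau>, of 1 1 "- 2 / 3" 0] by (simp add: theta_deriv_const_def t'_def t_def)
  have t'0: "theta_deriv_const 1 1 \<tau> = t' 0" by (simp add: theta_deriv_const_def t'_def t_def)
  obtain c where c: "\<And>z. t (z - 1 / 6) ^ 3 + t (z + 1 / 6) ^ 3
      = c * (t z * (theta_char 0 0 z \<tau> * theta_char 0 1 z \<tau>))"
    using sum_of_cubes_11[OF \<tau>] unfolding t_def by blast
  \<comment> \<open>The point \<open>1 / 2\<close> is useful because \<open>1 / 2 \<plusminus> 1 / 6\<close> are \<open>1 / 3\<close> and \<open>2 / 3\<close>, where \<open>t\<close> has the same value.\<close>
  have c_eq: "c * (s0 * u0 * v0) = 2 * a ^ 3"
    using c[of "1 / 2"] theta_00_add_half[OF \<tau>, of 0] theta_01_add_half[OF \<tau>, of 0]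
    by (simp add: t13 t23 t12 u0_def v0_def theta_const_def mult_ac)
  \<comment> \<open>As \<open>t\<close> vanishes at \<open>0\<close>, differentiation there leaves only \<open>t' 0\<close> on the right-hand side.\<close>
  have t'16: "6 * b\<^sup>2 * t' (1 / 6) = c * t' 0 * u0 * v0"
  proof -
    define G where "G = (\<lambda>z. theta_char 0 0 z \<tau> * theta_char 0 1 z \<tau>)"
    have dG: "(G has_field_derivative deriv G 0) (at 0)"
      unfolding G_def
      by (rule holomorphic_derivI[of _ UNIV]) (auto intro!: holomorphic_intros theta_char_holomorphic \<tau>)
    have "((\<lambda>z. t (z - 1 / 6) ^ 3 + t (z + 1 / 6) ^ 3) has_field_derivative
        3 * (t (- 1 / 6))\<^sup>2 * t' (- 1 / 6) + 3 * (t (1 / 6))\<^sup>2 * t' (1 / 6)) (at 0)"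
      by (auto intro!: derivative_eq_intros DERIV_chain2[OF dt] simp: power2_eq_square)
    moreover have "((\<lambda>z. c * (t z * G z)) has_field_derivative c * (t' 0 * G 0)) (at 0)"
      using t_odd[of 0] by (auto intro!: derivative_eq_intros dt dG)
    ultimately have "3 * (t (- 1 / 6))\<^sup>2 * t' (- 1 / 6) + 3 * (t (1 / 6))\<^sup>2 * t' (1 / 6) = c * (t' 0 * G 0)"
      unfolding c G_def by (rule DERIV_unique)
    then show ?thesis
      using t_odd[of "1 / 6"] t'_even[of "1 / 6"] by (simp add: t16 G_def u0_def v0_def theta_const_def mult_ac)
  qed
  obtain d where d: "\<And>z. t' z * theta_char 1 0 z \<tau> - t z * deriv (\<lambda>z. theta_char 1 0 z \<tau>) z
      = d * (theta_char 0 0 z \<tau> * theta_char 0 1 z \<tau>)"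
    using wronskian_11_10[OF \<tau>] unfolding t_def t'_def by blast
  have d_eq: "d * (u0 * v0) = t' 0 * s0"
    using d[of 0] t_odd[of 0] by (simp add: u0_def v0_def s0_def theta_const_def)
  \<comment> \<open>The Wronskian at \<open>- 1 / 3\<close>: the function \<open>\<theta>\<^sub>1\<^sub>0\<close> is \<open>t\<close> translated by \<open>1 / 2\<close>, and \<open>- 5 / 6\<close> is congruent to \<open>1 / 6\<close>.\<close>
  have main: "t' (- 1 / 3) * b + a * t' (1 / 6) = d * (u * v)"
  proof -
    have "theta_char 1 0 (- 1 / 3) \<tau> = b"
      using theta_10_eq[OF \<tau>, of "- 1 / 3"] t56 by (simp add: t_def)
    moreover have "deriv (\<lambda>z. theta_char 1 0 z \<tau>) (- 1 / 3) = t' (- 5 / 6)"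
      using deriv_theta_char_shift[OF \<tau>, of 1 1 "- 1" "- 1 / 3"] by (simp add: t'_def t_def)
    moreover have "t' (- 5 / 6) = - t' (1 / 6)" using t'_add_one[of "- 5 / 6"] by simp
    moreover have "t (- 1 / 3) = a" using t_odd[of "1 / 3"] t13 by simp
    moreover have "theta_char 0 0 (- 1 / 3) \<tau> = v"
      using theta_00_even[OF \<tau>, of "1 / 3"] theta_char_shift[of 0 0 0 "2 / 3" \<tau>] by (simp add: v_def theta_const_def)
    moreover have "theta_char 0 1 (- 1 / 3) \<tau> = u"
      using theta_00_add_half[OF \<tau>, of "- 1 / 3"] theta_char_shift[of 0 0 0 "1 / 3" \<tau>] by (simp add: u_def theta_const_def)
    ultimately show ?thesis using d[of "- 1 / 3"] by (simp add: mult_ac)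
  qed
  have first: "t' (- 1 / 3) / a = - (1 / 3) * (t' 0 * a ^ 3 / (s0 * b ^ 3)) + (t' 0 * s0 * u * v) / (u0 * v0 * a * b)"
  proof -
    have "6 * b\<^sup>2 * t' (1 / 6) * s0 = c * (s0 * u0 * v0) * t' 0" unfolding t'16 by (simp only: mult_ac)
    then have X: "t' (1 / 6) = a ^ 3 * t' 0 / (3 * s0 * b\<^sup>2)"
      unfolding c_eq using nz by (simp add: field_simps)
    have d: "d = t' 0 * s0 / (u0 * v0)" using d_eq nz by (simp add: field_simps)
    have D: "t' (- 1 / 3) = (d * (u * v) - a * t' (1 / 6)) / b"
      using main nz by (simp add: eq_divide_eq eq_diff_eq)
    show ?thesis
      unfolding D X d using nz by (simp add: divide_simps) (simp add: power2_eq_square power3_eq_cube algebra_simps)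
  qed
  have "t' 0 = - of_real pi * u0 * v0 * s0"
    using jacobi_derivative_formula[OF \<tau>] by (simp add: t'_def t_def u0_def v0_def s0_def theta_const_def)
  then have second: "- (1 / 3) * (t' 0 * a ^ 3 / (s0 * b ^ 3)) + (t' 0 * s0 * u * v) / (u0 * v0 * a * b)
     = of_real pi / 3 * u0 * v0 * (a ^ 3 / b ^ 3) - of_real pi * s0 ^ 2 * (u * v / (a * b))"
    using nz by (simp add: field_simps power2_eq_square)
  show ?thesis
    using first second unfolding t'13 t'0 a_def b_def u_def v_def s0_def u0_def v0_def by (rule conjI)
qed

end
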